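(* For integers $g\ge 0$ and $k\ge 1$, the class of graphs with $g$-thickness at most $k$ has defective chromatic number and defective choice number equal to $2k+1$. In particular, every graph with $g$-thickness at most $k$ is $(2k+1,\,2kg+8k^2+2k)$-choosable.
   Context: The $g$-thickness of a graph $G$ is the minimum integer $k$ such that $G$ is the union of $k$ subgraphs each of Euler genus at most $g$ (for $g=0$ this is the usual thickness: union of $k$ planar subgraphs). $G$ is $(k,d)$-colourable if each vertex can be assigned one of $k$ colours so that every vertex has at most $d$ neighbours of its own colour; $(k,d)$-choosable if for every assignment of lists $L(v)$ of exactly $k$ colours there is such a colouring with $c(v)\in L(v)$. The defective chromatic number (resp. choice number) of a class $\mathcal C$ is the minimum $k$ such that for some $d$ every graph in $\mathcal C$ is $(k,d)$-colourable (resp. $(k,d)$-choosable). *)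

theory Defs
  imports
    Complex_Main
    "HOL-Library.Extended_Nat"
    "Graph_Theory.Pair_Digraph"
    "Graph_Theory.Digraph_Component"
begin

text \<open>
  Finite simple undirected graphs are the symmetric loop-free finite pair digraphs,
  that is, the \<open>pair_graph\<close>s of \<open>Graph_Theory\<close>; an edge $uv$ is the pair of arcs
  \<open>(u,v)\<close>, \<open>(v,u)\<close>.

  Minima are taken in \<open>enat\<close>, so that the minimum over the empty set is \<open>\<infinity>\<close>.
\<close>

subsection \<open>Surfaces and Euler genus\<close>

text \<open>
  A cell decomposition of a closed connected surface is given by its barycentric
  subdivision. Each element of \<open>F\<close> is a triangle (a flag) with corners 0, 1, 2 lying at a
  vertex, at the midpoint of an edge and in the interior of a face of the decomposition. The
  triangle \<open>x\<close> is glued to \<open>a0 x\<close>, \<open>a1 x\<close>, \<open>a2 x\<close> along the side opposite to corner 0, 1, 2,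
  respectively. Fixed points would be boundary sides. The two conditions on \<open>a0\<close> and \<open>a2\<close> say
  that exactly four triangles meet at the midpoint of each edge. Loops and
  parallel edges are allowed, and the surface may be orientable or not.
\<close>

locale cell_surface =
  fixes F :: "'f set" and a0 a1 a2 :: "'f \<Rightarrow> 'f"
  assumes finite_flags: "finite F"
    and flags_nonempty: "F \<noteq> {}"
    and closed: "x \<in> F \<Longrightarrow> a0 x \<in> F \<and> a1 x \<in> F \<and> a2 x \<in> F"
    and involution: "x \<in> F \<Longrightarrow> a0 (a0 x) = x \<and> a1 (a1 x) = x \<and> a2 (a2 x) = x"
    and no_boundary: "x \<in> F \<Longrightarrow> a0 x \<noteq> x \<and> a1 x \<noteq> x \<and> a2 x \<noteq> x"
    and edge_commute: "x \<in> F \<Longrightarrow> a0 (a2 x) = a2 (a0 x)"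
    and edge_free: "x \<in> F \<Longrightarrow> a0 (a2 x) \<noteq> x"
    and connected: "x \<in> F \<Longrightarrow> y \<in> F \<Longrightarrow>
      (x, y) \<in> ({(z, a0 z) | z. z \<in> F} \<union> {(z, a1 z) | z. z \<in> F} \<union> {(z, a2 z) | z. z \<in> F})\<^sup>*"

text \<open>The orbits of the group generated by the involutions \<open>a\<close> and \<open>b\<close> of \<open>F\<close>.\<close>

definition orbits2 :: "'f set \<Rightarrow> ('f \<Rightarrow> 'f) \<Rightarrow> ('f \<Rightarrow> 'f) \<Rightarrow> 'f set set" where
  "orbits2 F a b =
     F // {(x, y). x \<in> F \<and> (x, y) \<in> ({(z, a z) | z. z \<in> F} \<union> {(z, b z) | z. z \<in> F})\<^sup>*}"

text \<open>
  The triangles around a given vertex, edge or face of the decomposition form an orbit of the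
  two involutions that fix the corresponding corner.
\<close>

definition surface_vertices :: "'f set \<Rightarrow> ('f \<Rightarrow> 'f) \<Rightarrow> ('f \<Rightarrow> 'f) \<Rightarrow> ('f \<Rightarrow> 'f) \<Rightarrow> 'f set set" where
  "surface_vertices F a0 a1 a2 = orbits2 F a1 a2"

definition surface_edges :: "'f set \<Rightarrow> ('f \<Rightarrow> 'f) \<Rightarrow> ('f \<Rightarrow> 'f) \<Rightarrow> ('f \<Rightarrow> 'f) \<Rightarrow> 'f set set" where
  "surface_edges F a0 a1 a2 = orbits2 F a0 a2"

definition surface_faces :: "'f set \<Rightarrow> ('f \<Rightarrow> 'f) \<Rightarrow> ('f \<Rightarrow> 'f) \<Rightarrow> ('f \<Rightarrow> 'f) \<Rightarrow> 'f set set" where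
  "surface_faces F a0 a1 a2 = orbits2 F a0 a1"

definition euler_characteristic ::
  "'f set \<Rightarrow> ('f \<Rightarrow> 'f) \<Rightarrow> ('f \<Rightarrow> 'f) \<Rightarrow> ('f \<Rightarrow> 'f) \<Rightarrow> int" where
  "euler_characteristic F a0 a1 a2 =
     int (card (surface_vertices F a0 a1 a2)) - int (card (surface_edges F a0 a1 a2))
       + int (card (surface_faces F a0 a1 a2))"

text \<open>
  Twice the number of handles of an orientable surface, and the number of cross-caps of a
  non-orientable one.
\<close>

definition surface_euler_genus ::
  "'f set \<Rightarrow> ('f \<Rightarrow> 'f) \<Rightarrow> ('f \<Rightarrow> 'f) \<Rightarrow> ('f \<Rightarrow> 'f) \<Rightarrow> int" where
  "surface_euler_genus F a0 a1 a2 = 2 - euler_characteristic F a0 a1 a2"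

text \<open>
  \<open>G\<close> is drawn in the vertex-edge skeleton of the decomposition: distinct vertices of \<open>G\<close> are
  distinct vertices of the decomposition, and adjacent ones are joined by an edge of it. As \<open>G\<close>
  is simple, distinct edges of \<open>G\<close> use distinct edges of the decomposition. The
  decomposition may have further vertices and edges, so \<open>G\<close> itself need not be cellularly
  embedded and need not be connected.
\<close>

definition embeds_in_surface ::
  "'a pair_pre_digraph \<Rightarrow> 'f set \<Rightarrow> ('f \<Rightarrow> 'f) \<Rightarrow> ('f \<Rightarrow> 'f) \<Rightarrow> ('f \<Rightarrow> 'f) \<Rightarrow> bool" where
  "embeds_in_surface G F a0 a1 a2 \<longleftrightarrow>
     (\<exists>f. inj_on f (pverts G) \<and> f ` pverts G \<subseteq> surface_vertices F a0 a1 a2 \<and>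
          (\<forall>(u, v) \<in> parcs G. \<exists>x \<in> f u. a0 x \<in> f v))"

definition euler_genus :: "'a pair_pre_digraph \<Rightarrow> enat" where
  "euler_genus G =
     Inf {enat g | g. \<exists>(F :: nat set) a0 a1 a2. cell_surface F a0 a1 a2 \<and>
            surface_euler_genus F a0 a1 a2 = int g \<and> embeds_in_surface G F a0 a1 a2}"

subsection \<open>Thickness\<close>

definition g_thickness :: "nat \<Rightarrow> 'a pair_pre_digraph \<Rightarrow> enat" where
  "g_thickness g G =
     Inf {enat k | k. \<exists>H :: nat \<Rightarrow> 'a pair_pre_digraph.
            (\<forall>i<k. pair_graph (H i) \<and> subgraph (with_proj (H i)) (with_proj G) \<and>
                   euler_genus (H i) \<le> enat g) \<and>
            pverts G = (\<Union>i<k. pverts (H i)) \<and> parcs G = (\<Union>i<k. parcs (H i))}"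

subsection \<open>Defective colouring\<close>

definition has_defect :: "'a pair_pre_digraph \<Rightarrow> nat \<Rightarrow> ('a \<Rightarrow> nat) \<Rightarrow> bool" where
  "has_defect G d c \<longleftrightarrow> (\<forall>v \<in> pverts G. card {w. (v, w) \<in> parcs G \<and> c w = c v} \<le> d)"

definition defective_colourable :: "nat \<Rightarrow> nat \<Rightarrow> 'a pair_pre_digraph \<Rightarrow> bool" where
  "defective_colourable k d G \<longleftrightarrow> (\<exists>c. (\<forall>v \<in> pverts G. c v < k) \<and> has_defect G d c)"

definition defective_choosable :: "nat \<Rightarrow> nat \<Rightarrow> 'a pair_pre_digraph \<Rightarrow> bool" where
  "defective_choosable k d G \<longleftrightarrow>
     (\<forall>L :: 'a \<Rightarrow> nat set. (\<forall>v \<in> pverts G. finite (L v) \<and> card (L v) = k) \<longrightarrow>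
        (\<exists>c. (\<forall>v \<in> pverts G. c v \<in> L v) \<and> has_defect G d c))"

definition defective_chromatic_number :: "'a pair_pre_digraph set \<Rightarrow> enat" where
  "defective_chromatic_number \<C> = Inf {enat k | k. \<exists>d. \<forall>G \<in> \<C>. defective_colourable k d G}"

definition defective_choice_number :: "'a pair_pre_digraph set \<Rightarrow> enat" where
  "defective_choice_number \<C> = Inf {enat k | k. \<exists>d. \<forall>G \<in> \<C>. defective_choosable k d G}"

text \<open>
  Every finite graph is isomorphic to one on natural numbers, so with \<open>'a = nat\<close> this is,
  up to isomorphism, the class of all graphs with $g$-thickness at most $k$.
\<close>

definition thickness_class :: "nat \<Rightarrow> nat \<Rightarrow> 'a pair_pre_digraph set" where
  "thickness_class g k = {G. pair_graph G \<and> g_thickness g G \<le> enat k}"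

end

theory Submission
  imports Defs "HOL-Library.Nat_Bijection"
begin

text \<open>
  Upper bound. For a graph drawn in the skeleton of a cell decomposition, delete the superfluous
  edges one at a time: deleting a bridge leaves the number of regions unchanged and deleting any
  other edge merges at most two regions, so $V - E + R \ge \chi + c - 1$ persists, where $R$ and $c$
  count regions and components. A region of a simple graph has at least three sides (four if the
  graph is bipartite), which gives at most $3(n + g - 2)$ and $2(n + g - 2)$ edges. Hence a graph of
  $g$-thickness at most $k$ and minimum degree at least $2k + 1$ has an edge both of whose ends
  have degree at most $2kg + 8k^2 + 4k$. Colour the graph without this edge by induction; an end
  that then exceeds the defect sees at most $2k$ colours and can be recoloured.

  Lower bound. In the closure of a complete $N$-ary tree of height $2k$ with large $N$, every
  colouring of bounded defect has a root-to-leaf path with $2k + 1$ distinct colours. The edges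
  from vertices to their ancestors at depths $2i$ and $2i + 1$ form a planar graph, so $k$ planar
  graphs cover the closure.
\<close>

subsection \<open>Counting\<close>

text \<open>Euler's formula cannot be applied directly: a graph on a surface need not be connected
  or cellularly embedded, and the skeleton may have loops, parallel edges and further vertices. The
  full skeleton satisfies it by definition, and deleting edges turns all topology into counting
  orbits of three involutions. Where a Jordan-type argument would be expected (a bridge has one
  region on both sides, a boundary walk closes up), the parity of flag sets matched by
  fixed-point-free involutions takes its place. An edge has four flags, a side of it in a region has
  two, and an edge of a graph is two arcs; this explains the various factors of two in the bounds.

  Planarity in the lower bound requires explicit surfaces. One operation suffices: joining a new
  vertex to both ends of an edge already drawn. Coning all faces at once realises it uniformly,
  without singling out a face to modify. Excess vertices and edges do no harm, because an embedding
  only asks for containment in the skeleton.\<close>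

lemma even_card_involution:
  assumes "finite X" "\<And>x. x \<in> X \<Longrightarrow> h x \<in> X \<and> h (h x) = x \<and> h x \<noteq> x"
  shows "even (card X)"
  using assms
proof (induction X rule: finite_psubset_induct)
  case (psubset X)
  show ?case
  proof (cases "X = {}")
    case False
    then obtain x where x: "x \<in> X" by blast
    have hx: "h x \<in> X" "h (h x) = x" "h x \<noteq> x" using psubset.prems[OF x] by auto
    have "even (card (X - {x, h x}))"
    proof (rule psubset.IH)
      show "X - {x, h x} \<subset> X" using x by blast
      fix y assume y: "y \<in> X - {x, h x}"
      then have hy: "h y \<in> X" "h (h y) = y" "h y \<noteq> y" using psubset.prems[of y] by auto
      moreover have "h y \<noteq> x" using y hy(2) by auto
      moreover have "h y \<noteq> h x" using y hy(2) hx(2) by auto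
      ultimately show "h y \<in> X - {x, h x} \<and> h (h y) = y \<and> h y \<noteq> y" by blast
    qed
    moreover have "card X = card (X - {x, h x}) + 2"
      using card_Diff_subset[of "{x, h x}" X] card_mono[of X "{x, h x}"] psubset.hyps x hx by simp
    ultimately show ?thesis by simp
  qed simp
qed

lemma card_eq_sum_fibres:
  assumes "finite D"
  shows "card D = (\<Sum>c\<in>f ` D. card {y \<in> D. f y = c})"
  using sum.image_gen[OF assms, of "\<lambda>_. 1::nat" f] by simp

lemma card_eq_mult_fibres:
  assumes "finite D" "\<And>x. x \<in> D \<Longrightarrow> card {y \<in> D. f y = f x} = m"
  shows "card D = m * card (f ` D)"
proof -
  have "(\<Sum>c\<in>f ` D. card {y \<in> D. f y = c}) = (\<Sum>c\<in>f ` D. m)"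
    by (rule sum.cong) (use assms(2) in auto)
  then show ?thesis using card_eq_sum_fibres[OF assms(1), of f] by simp
qed

subsection \<open>Classes of a symmetric relation\<close>

definition class_of :: "('a \<times> 'a) set \<Rightarrow> 'a \<Rightarrow> 'a set" where
  "class_of R x = R\<^sup>* `` {x}"

lemma mem_class_of: "y \<in> class_of R x \<longleftrightarrow> (x, y) \<in> R\<^sup>*"
  by (simp add: class_of_def)

lemma class_of_refl [simp]: "x \<in> class_of R x"
  by (simp add: mem_class_of)

lemma class_of_eq:
  assumes "sym R" "(x, y) \<in> R\<^sup>*"
  shows "class_of R x = class_of R y"
proof -
  have "(y, x) \<in> R\<^sup>*" using sym_rtrancl[OF assms(1)] assms(2) by (rule symD)
  then show ?thesis using assms(2) unfolding class_of_def by (auto intro: rtrancl_trans)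
qed

lemma class_of_eq_iff:
  assumes "sym R"
  shows "class_of R x = class_of R y \<longleftrightarrow> (x, y) \<in> R\<^sup>*"
  using class_of_eq[OF assms] class_of_refl[of y R] by (auto simp: mem_class_of)

lemma class_of_subset:
  assumes "x \<in> X" "\<And>y z. (y, z) \<in> R \<Longrightarrow> y \<in> X \<Longrightarrow> z \<in> X"
  shows "class_of R x \<subseteq> X"
proof -
  have "y \<in> X" if "(x, y) \<in> R\<^sup>*" for y
    using that by induction (use assms in auto)
  then show ?thesis by (auto simp: mem_class_of)
qed

lemma class_of_insert_pair:
  assumes "sym R" "(a, b) \<notin> R\<^sup>*"
  shows "class_of (R \<union> {(a, b), (b, a)}) x =
    (if x \<in> class_of R a \<union> class_of R b then class_of R a \<union> class_of R b else class_of R x)"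
proof -
  let ?R = "R \<union> {(a, b), (b, a)}" and ?U = "class_of R a \<union> class_of R b"
  have mono: "R\<^sup>* \<subseteq> ?R\<^sup>*" by (rule rtrancl_mono) auto
  have sym': "sym ?R" using assms(1) by (auto simp: sym_def)
  have U: "class_of ?R y = class_of ?R a" if "y \<in> ?U" for y
  proof -
    have "(a, y) \<in> ?R\<^sup>* \<or> (b, y) \<in> ?R\<^sup>*" using that mono by (auto simp: mem_class_of)
    moreover have "(a, b) \<in> ?R\<^sup>*" by auto
    ultimately show ?thesis using class_of_eq[OF sym'] by metis
  qed
  have step: "y \<in> ?U \<Longrightarrow> (y, z) \<in> R \<Longrightarrow> z \<in> ?U" for y z
    by (auto simp: mem_class_of intro: rtrancl_into_rtrancl)
  show ?thesis
  proof (cases "x \<in> ?U")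
    case True
    have "class_of ?R x \<subseteq> ?U"
      by (rule class_of_subset[OF True]) (use step in auto)
    moreover have "?U \<subseteq> class_of ?R x"
    proof
      fix y assume "y \<in> ?U"
      then have "class_of ?R y = class_of ?R x" by (rule trans[OF U U[OF True, symmetric]])
      then show "y \<in> class_of ?R x" using class_of_refl[of y ?R] by (simp only:)
    qed
    ultimately have "class_of ?R x = ?U" by (rule equalityI)
    then show ?thesis using True by (simp only: if_True)
  next
    case False
    have "class_of ?R x \<subseteq> class_of R x"
    proof (rule class_of_subset)
      fix y z assume yz: "(y, z) \<in> ?R" "y \<in> class_of R x"
      have "y \<noteq> a" "y \<noteq> b" using yz(2) False class_of_eq_iff[OF assms(1)]
        by (metis UnI1 UnI2 class_of_refl mem_class_of)+
      then show "z \<in> class_of R x" using yz by (auto simp: mem_class_of)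
    qed simp
    moreover have "class_of R x \<subseteq> class_of ?R x" using mono by (auto simp: mem_class_of)
    ultimately show ?thesis using False by auto
  qed
qed

text \<open>One count serves two purposes: adding an edge inserts a pair into the component relation
  and, read backwards, removes one from the region relation.\<close>

lemma card_classes_insert_pair:
  assumes "sym R" "finite F" "a \<in> F" "b \<in> F"
  defines "R' \<equiv> R \<union> {(a, b), (b, a)}"
  shows "(a, b) \<in> R\<^sup>* \<Longrightarrow> card (class_of R' ` F) = card (class_of R ` F)"
    and "(a, b) \<notin> R\<^sup>* \<Longrightarrow> card (class_of R ` F) = Suc (card (class_of R' ` F))"
proof -
  assume ab: "(a, b) \<in> R\<^sup>*"
  then have "(b, a) \<in> R\<^sup>*" using sym_rtrancl[OF assms(1)] by (auto simp: sym_def)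
  then have "R'\<^sup>* = R\<^sup>*" using ab unfolding R'_def
    by (intro equalityI rtrancl_subset_rtrancl rtrancl_mono) auto
  then show "card (class_of R' ` F) = card (class_of R ` F)" by (simp add: class_of_def)
next
  assume ab: "(a, b) \<notin> R\<^sup>*"
  let ?A = "class_of R a" and ?B = "class_of R b" and ?C = "class_of R ` F"
  have AB: "?A \<noteq> ?B" using ab class_of_eq_iff[OF assms(1)] by blast
  have cl: "class_of R' x = (if x \<in> ?A \<union> ?B then ?A \<union> ?B else class_of R x)" for x
    unfolding R'_def by (rule class_of_insert_pair[OF assms(1) ab])
  have iff: "x \<in> class_of R y \<longleftrightarrow> class_of R x = class_of R y" for x y
    using class_of_eq_iff[OF assms(1)] by (metis mem_class_of)
  have "class_of R' ` F = insert (?A \<union> ?B) (?C - {?A, ?B})"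
  proof
    show "class_of R' ` F \<subseteq> insert (?A \<union> ?B) (?C - {?A, ?B})"
      using cl iff by auto
    have "?A \<union> ?B = class_of R' a" using cl by simp
    moreover have "class_of R x \<in> class_of R' ` F" if "x \<in> F" "class_of R x \<notin> {?A, ?B}" for x
    proof -
      have "class_of R' x = class_of R x" using cl[of x] iff[of x] that(2) by auto
      then show ?thesis using that(1) by (metis image_eqI)
    qed
    ultimately show "insert (?A \<union> ?B) (?C - {?A, ?B}) \<subseteq> class_of R' ` F"
      using assms(3) by auto
  qed
  moreover have "?A \<union> ?B \<notin> ?C"
  proof
    assume "?A \<union> ?B \<in> ?C"
    then obtain x where "class_of R x = ?A \<union> ?B" by auto
    then have "a \<in> class_of R x" "b \<in> class_of R x" by auto
    then show False using iff AB by metis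
  qed
  moreover have "finite ?C" "?A \<in> ?C" "?B \<in> ?C" using assms by auto
  moreover have "card ?C \<ge> card {?A, ?B}" using calculation by (intro card_mono) auto
  ultimately show "card ?C = Suc (card (class_of R' ` F))"
    using AB card_Diff_subset[of "{?A, ?B}" ?C] by simp
qed

subsection \<open>Flags of a cell decomposition\<close>

definition steps :: "'f set \<Rightarrow> ('f \<Rightarrow> 'f) \<Rightarrow> ('f \<times> 'f) set" where
  "steps F a = {(z, a z) | z. z \<in> F}"

lemma in_steps [simp]: "(x, y) \<in> steps F a \<longleftrightarrow> x \<in> F \<and> y = a x"
  by (auto simp: steps_def)

lemma sym_steps:
  assumes "\<And>x. x \<in> F \<Longrightarrow> a x \<in> F \<and> a (a x) = x"
  shows "sym (steps F a)"
  using assms by (auto intro!: symI)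

lemma orbits2_eq_classes: "orbits2 F a b = class_of (steps F a \<union> steps F b) ` F"
  by (auto simp: orbits2_def quotient_def class_of_def steps_def)

context cell_surface
begin

lemma flagD:
  assumes "x \<in> F"
  shows "a0 x \<in> F" "a1 x \<in> F" "a2 x \<in> F" "a0 (a0 x) = x" "a1 (a1 x) = x" "a2 (a2 x) = x"
    "a0 x \<noteq> x" "a1 x \<noteq> x" "a2 x \<noteq> x" "a2 (a0 x) = a0 (a2 x)" "a0 (a2 x) \<noteq> x"
  using closed involution no_boundary edge_commute edge_free assms by auto

section \<open>Vertices, edges and subgraphs of the skeleton\<close>

definition vertex_of :: "'f \<Rightarrow> 'f set" where
  "vertex_of = class_of (steps F a1 \<union> steps F a2)"

lemma sym_vertex_steps: "sym (steps F a1 \<union> steps F a2)"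
  by (intro sym_Un sym_steps) (auto simp: flagD)

lemma surface_vertices_eq: "surface_vertices F a0 a1 a2 = vertex_of ` F"
  by (simp add: surface_vertices_def orbits2_eq_classes vertex_of_def)

lemma vertex_of_step:
  assumes "x \<in> F"
  shows "vertex_of (a1 x) = vertex_of x" "vertex_of (a2 x) = vertex_of x"
proof -
  have "(x, a1 x) \<in> (steps F a1 \<union> steps F a2)\<^sup>*" "(x, a2 x) \<in> (steps F a1 \<union> steps F a2)\<^sup>*"
    using assms by auto
  then show "vertex_of (a1 x) = vertex_of x" "vertex_of (a2 x) = vertex_of x"
    unfolding vertex_of_def using class_of_eq[OF sym_vertex_steps] by metis+
qed

lemma vertex_of_eq:
  assumes "v \<in> surface_vertices F a0 a1 a2" "x \<in> v"
  shows "x \<in> F" "vertex_of x = v"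
proof -
  obtain y where y: "y \<in> F" "v = vertex_of y" using assms(1) by (auto simp: surface_vertices_eq)
  have "class_of (steps F a1 \<union> steps F a2) y \<subseteq> F"
    by (rule class_of_subset[OF y(1)]) (auto simp: flagD)
  then show "x \<in> F" using y assms(2) by (auto simp: vertex_of_def)
  show "vertex_of x = v" using y assms(2) class_of_eq[OF sym_vertex_steps, of y x]
    by (auto simp: vertex_of_def mem_class_of)
qed

text \<open>The orbit of \<open>x\<close> under the commuting involutions \<open>a0\<close> and
  \<open>a2\<close> in explicit form; \<open>edge_free\<close> contributes to its four elements
  being distinct.\<close>

definition edge_of :: "'f \<Rightarrow> 'f set" where
  "edge_of x = {x, a0 x, a2 x, a0 (a2 x)}"

lemma card_edge_of: "x \<in> F \<Longrightarrow> card (edge_of x) = 4"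
  using flagD[of x] flagD[of "a2 x"] by (auto simp: edge_of_def card_insert_if)

text \<open>Such a \<open>D\<close> is a union of edge orbits, so it encodes an arbitrary set of
  edges of the skeleton; its complement in \<open>F\<close> is then a union of edge orbits as
  well.\<close>

definition edge_closed :: "'f set \<Rightarrow> bool" where
  "edge_closed D \<longleftrightarrow> D \<subseteq> F \<and> (\<forall>x\<in>D. a0 x \<in> D \<and> a2 x \<in> D)"

lemma edge_closedD:
  assumes "edge_closed D"
  shows "D \<subseteq> F" "x \<in> D \<Longrightarrow> a0 x \<in> D" "x \<in> D \<Longrightarrow> a2 x \<in> D"
  using assms by (auto simp: edge_closed_def)

lemma edge_closed_iff:
  assumes "edge_closed D" "x \<in> F"
  shows "a0 x \<in> D \<longleftrightarrow> x \<in> D" "a2 x \<in> D \<longleftrightarrow> x \<in> D"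
  using edge_closedD[OF assms(1)] flagD[OF assms(2)] by metis+

lemma edge_of_subset:
  assumes "edge_closed D" "x \<in> D"
  shows "edge_of x \<subseteq> D"
  using assms edge_closedD[OF assms(1)] by (auto simp: edge_of_def)

lemma edge_of_closed:
  assumes "x \<in> F" "y \<in> edge_of x"
  shows "y \<in> F" "a0 y \<in> edge_of x" "a2 y \<in> edge_of x" "edge_of y = edge_of x"
  using assms flagD[of x] flagD[of "a2 x"] by (auto simp: edge_of_def)

lemma edge_of_refl [simp]: "x \<in> edge_of x"
  by (simp add: edge_of_def)

lemma card_closed_eq_edges:
  assumes D: "edge_closed D"
  shows "card D = 4 * card (edge_of ` D)"
proof (rule card_eq_mult_fibres)
  show "finite D" using edge_closedD(1)[OF D] finite_flags by (rule finite_subset)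
  fix x assume x: "x \<in> D"
  have "{y \<in> D. edge_of y = edge_of x} = edge_of x"
    using edge_of_subset[OF D x] edge_of_closed(4)[of x] x edge_closedD(1)[OF D] edge_of_refl by blast
  then show "card {y \<in> D. edge_of y = edge_of x} = 4" using card_edge_of x edge_closedD(1)[OF D] by auto
qed

lemma surface_edges_eq: "surface_edges F a0 a1 a2 = edge_of ` F"
proof -
  have "class_of (steps F a0 \<union> steps F a2) x = edge_of x" if x: "x \<in> F" for x
  proof
    show "class_of (steps F a0 \<union> steps F a2) x \<subseteq> edge_of x"
      by (rule class_of_subset) (use edge_of_closed(1-3)[OF x] in auto)
    have "(x, a0 x) \<in> (steps F a0 \<union> steps F a2)\<^sup>*" "(x, a2 x) \<in> (steps F a0 \<union> steps F a2)\<^sup>*"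
      "(a2 x, a0 (a2 x)) \<in> (steps F a0 \<union> steps F a2)\<^sup>*"
      by (rule r_into_rtrancl, use x flagD(3)[of x] in simp)+
    then show "edge_of x \<subseteq> class_of (steps F a0 \<union> steps F a2) x"
      by (auto simp: edge_of_def mem_class_of intro: rtrancl_trans)
  qed
  then show ?thesis by (simp add: surface_edges_def orbits2_eq_classes)
qed

text \<open>
  A subgraph of the skeleton is given by the set \<open>D\<close> of the flags on its edges. The classes of
  the first relation are its components, including all isolated vertices. Those of the second
  relation are the regions into which it cuts the surface.
\<close>

definition component_steps :: "'f set \<Rightarrow> ('f \<times> 'f) set" where
  "component_steps D = steps F a1 \<union> steps F a2 \<union> steps D a0"

definition region_steps :: "'f set \<Rightarrow> ('f \<times> 'f) set" where
  "region_steps D = steps F a0 \<union> steps F a1 \<union> steps (F - D) a2"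

abbreviation "components D \<equiv> class_of (component_steps D) ` F"

abbreviation "regions D \<equiv> class_of (region_steps D) ` F"

lemma sym_component_steps:
  assumes D: "edge_closed D"
  shows "sym (component_steps D)"
proof -
  have "x \<in> D \<Longrightarrow> x \<in> F" for x using edge_closedD(1)[OF D] by auto
  then show ?thesis
    unfolding component_steps_def by (intro sym_Un sym_steps) (auto simp: flagD edge_closedD[OF D])
qed

lemma sym_region_steps:
  assumes D: "edge_closed D"
  shows "sym (region_steps D)"
  unfolding region_steps_def
  by (intro sym_Un sym_steps) (auto simp: flagD(1-6) edge_closed_iff[OF D])

lemma edge_closed_insert:
  assumes "edge_closed D" "x \<in> F"
  shows "edge_closed (D \<union> edge_of x)"
  using assms(1) edge_of_closed(1-3)[OF assms(2)] unfolding edge_closed_def by blast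

lemma edge_of_disjoint:
  assumes "edge_closed D" "x \<in> F - D"
  shows "D \<inter> edge_of x = {}"
proof -
  have "y \<notin> D" if "y \<in> edge_of x" for y
  proof
    assume "y \<in> D"
    then have "edge_of x \<subseteq> D" using edge_of_subset[OF assms(1)] edge_of_closed(4)[OF _ that] assms(2) by auto
    then show False using assms(2) edge_of_refl by blast
  qed
  then show ?thesis by blast
qed

text \<open>The four flags of an edge give two candidate pairs, but the \<open>a2\<close>-steps (for
  components) and the \<open>a0\<close>-steps (for regions) along this edge are present anyway and
  identify the two, so a single pair remains. Regions are related in the opposite direction, since
  enlarging \<open>D\<close> forbids \<open>a2\<close>-steps.\<close>

lemma add_edge:
  assumes D: "edge_closed D" and x_notin: "x \<in> F - D"
  shows "(component_steps (D \<union> edge_of x))\<^sup>* = (component_steps D \<union> {(x, a0 x), (a0 x, x)})\<^sup>*"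
    and "(region_steps D)\<^sup>* = (region_steps (D \<union> edge_of x) \<union> {(x, a2 x), (a2 x, x)})\<^sup>*"
proof -
  have x: "x \<in> F" using x_notin by simp
  let ?P = "component_steps D \<union> {(x, a0 x), (a0 x, x)}"
  let ?Q = "region_steps (D \<union> edge_of x) \<union> {(x, a2 x), (a2 x, x)}"
  have "steps (edge_of x) a0 \<subseteq> ?P\<^sup>*"
  proof -
    have 1: "(x, a0 x) \<in> ?P" "(a0 x, x) \<in> ?P" "(x, a2 x) \<in> ?P" "(a2 x, x) \<in> ?P"
      "(a0 x, a0 (a2 x)) \<in> ?P" "(a0 (a2 x), a0 x) \<in> ?P"
      using x flagD[of x] flagD[of "a2 x"] flagD[of "a0 x"] by (auto simp: component_steps_def)
    have "(a2 x, a0 (a2 x)) \<in> ?P\<^sup>*" using 1(1,4,5) by (meson r_into_rtrancl rtrancl_trans)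
    moreover have "(a0 (a2 x), a2 x) \<in> ?P\<^sup>*" using 1(2,3,6) by (meson r_into_rtrancl rtrancl_trans)
    ultimately show ?thesis using 1 x flagD[of x] flagD[of "a2 x"] by (auto simp: edge_of_def)
  qed
  moreover have "component_steps D \<subseteq> ?P\<^sup>*" by auto
  moreover have "component_steps (D \<union> edge_of x) = component_steps D \<union> steps (edge_of x) a0"
    by (auto simp: component_steps_def)
  ultimately have "component_steps (D \<union> edge_of x) \<subseteq> ?P\<^sup>*" by simp
  moreover have "?P \<subseteq> component_steps (D \<union> edge_of x)"
    using x flagD[of x] by (auto simp: component_steps_def edge_of_def)
  ultimately show "(component_steps (D \<union> edge_of x))\<^sup>* = ?P\<^sup>*"
    by (metis rtrancl_subset)
  have "steps (edge_of x) a2 \<subseteq> ?Q\<^sup>*"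
  proof -
    have 1: "(x, a0 x) \<in> ?Q" "(a0 x, x) \<in> ?Q" "(x, a2 x) \<in> ?Q" "(a2 x, x) \<in> ?Q"
      "(a2 x, a0 (a2 x)) \<in> ?Q" "(a0 (a2 x), a2 x) \<in> ?Q"
      using x flagD[of x] flagD[of "a2 x"] flagD[of "a0 x"] by (auto simp: region_steps_def)
    have "(a0 x, a0 (a2 x)) \<in> ?Q\<^sup>*" using 1(2,3,5) by (meson r_into_rtrancl rtrancl_trans)
    moreover have "(a0 (a2 x), a0 x) \<in> ?Q\<^sup>*" using 1(1,4,6) by (meson r_into_rtrancl rtrancl_trans)
    ultimately show ?thesis using 1 x flagD[of x] flagD[of "a2 x"] flagD[of "a0 x"]
      by (auto simp: edge_of_def)
  qed
  moreover have "region_steps (D \<union> edge_of x) \<subseteq> ?Q\<^sup>*" by auto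
  moreover have "region_steps D \<subseteq> region_steps (D \<union> edge_of x) \<union> steps (edge_of x) a2"
    by (auto simp: region_steps_def)
  ultimately have "region_steps D \<subseteq> ?Q\<^sup>*" by blast
  moreover have "?Q \<subseteq> region_steps D"
    using x flagD[of x] x_notin edge_closed_iff(2)[OF D] by (auto simp: region_steps_def)
  ultimately show "(region_steps D)\<^sup>* = ?Q\<^sup>*"
    by (metis rtrancl_subset)
qed

text \<open>
  If the edge of \<open>x\<close> joins the component \<open>K\<close> of \<open>x\<close> to another one, then both sides of this
  edge lie in the same region \<open>C\<close>: otherwise \<open>x\<close> is the only flag of that edge in
  \<open>X = K \<inter> C\<close>, whereas \<open>a1\<close>, \<open>a2\<close> and \<open>a0\<close> match the flags of \<open>X\<close>, of \<open>X\<close> off the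
  enlarged subgraph, and of \<open>X\<close> on the old subgraph in pairs.
\<close>

lemma bridge_sides:
  assumes D: "edge_closed D" and x: "x \<in> F - D"
    and bridge: "(x, a0 x) \<notin> (component_steps D)\<^sup>*"
  shows "(x, a2 x) \<in> (region_steps (D \<union> edge_of x))\<^sup>*"
proof (rule ccontr)
  assume sep: "(x, a2 x) \<notin> (region_steps (D \<union> edge_of x))\<^sup>*"
  let ?D = "D \<union> edge_of x"
  define K where "K = class_of (component_steps D) x"
  define C where "C = class_of (region_steps ?D) x"
  define X where "X = K \<inter> C"
  have xF: "x \<in> F" using x by simp
  have D': "edge_closed ?D" by (rule edge_closed_insert[OF D xF])
  have KF: "K \<subseteq> F" unfolding K_def
    by (rule class_of_subset[OF xF]) (use edge_closedD[OF D] in \<open>auto simp: component_steps_def flagD\<close>)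
  have K: "y \<in> K \<Longrightarrow> a1 y \<in> K" "y \<in> K \<Longrightarrow> a2 y \<in> K" "y \<in> K \<Longrightarrow> y \<in> D \<Longrightarrow> a0 y \<in> K" for y
    using KF rtrancl_into_rtrancl[of x y "component_steps D"]
    by (auto simp: K_def mem_class_of component_steps_def)
  have C: "y \<in> F \<Longrightarrow> y \<in> C \<Longrightarrow> a0 y \<in> C" "y \<in> F \<Longrightarrow> y \<in> C \<Longrightarrow> a1 y \<in> C"
    "y \<in> F \<Longrightarrow> y \<in> C \<Longrightarrow> y \<notin> ?D \<Longrightarrow> a2 y \<in> C" for y
    using rtrancl_into_rtrancl[of x y "region_steps ?D"]
    by (auto simp: C_def mem_class_of region_steps_def)
  have XF: "X \<subseteq> F" and fin: "finite X" using KF finite_flags finite_subset by (auto simp: X_def)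
  have "even (card X)"
    by (rule even_card_involution[of _ a1]) (use fin XF K C flagD in \<open>auto simp: X_def\<close>)
  moreover have "even (card (X - ?D))"
  proof (rule even_card_involution[of _ a2])
    fix y assume y: "y \<in> X - ?D"
    then have yF: "y \<in> F" using XF by auto
    then have "a2 y \<notin> ?D" using y edge_closed_iff(2)[OF D' yF] by blast
    then show "a2 y \<in> X - ?D \<and> a2 (a2 y) = y \<and> a2 y \<noteq> y"
      using y yF K C flagD by (auto simp: X_def)
  qed (use fin in auto)
  moreover have "even (card (X \<inter> D))"
    by (rule even_card_involution[of _ a0]) (use fin XF K C edge_closedD[OF D] flagD in \<open>auto simp: X_def\<close>)
  moreover have "X \<inter> edge_of x = {x}"
  proof -
    have "a0 x \<notin> K" using bridge by (simp add: K_def mem_class_of)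
    moreover have "a0 (a2 x) \<notin> K" using K(2)[of "a0 (a2 x)"] calculation flagD[OF xF]
        flagD[OF flagD(3)[OF xF]] by auto
    moreover have "a2 x \<notin> C" using sep by (simp add: C_def mem_class_of)
    moreover have "x \<in> X" by (simp add: X_def K_def C_def)
    ultimately show ?thesis by (auto simp: X_def edge_of_def)
  qed
  moreover have "card X = card (X - ?D) + card (X \<inter> D) + card (X \<inter> edge_of x)"
  proof -
    have "D \<inter> edge_of x = {}" by (rule edge_of_disjoint[OF D x])
    then have "card (X \<inter> ?D) = card (X \<inter> D) + card (X \<inter> edge_of x)"
      using fin by (subst card_Un_disjoint[symmetric]) (auto simp: Int_Un_distrib)
    then show ?thesis using card_Int_Diff[OF fin, of ?D] by simp
  qed
  ultimately show False by simp
qed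

text \<open>Everything is multiplied by four so that \<open>card D\<close> can stand for the number
  of edges. The induction runs downwards from \<open>D = F\<close>.\<close>

lemma subgraph_euler_inequality:
  assumes "edge_closed D"
  shows "4 * euler_characteristic F a0 a1 a2 + 4 * (int (card (components D)) - 1) + int (card D)
    \<le> 4 * int (card (surface_vertices F a0 a1 a2)) + 4 * int (card (regions D))"
  using assms
proof (induction "card (F - D)" arbitrary: D rule: less_induct)
  case less
  note D = less.prems
  show ?case
  proof (cases "D = F")
    \<comment> \<open>With all edges present there is one component, the regions are the faces, and
      equality holds by definition of the Euler characteristic.\<close>
    case True
    obtain x where x: "x \<in> F" using flags_nonempty by blast
    have "class_of (component_steps F) y = F" if y: "y \<in> F" for y
    proof
      show "class_of (component_steps F) y \<subseteq> F"
        by (rule class_of_subset[OF y]) (auto simp: component_steps_def flagD)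
      show "F \<subseteq> class_of (component_steps F) y"
        using connected[OF y] by (auto simp: mem_class_of component_steps_def steps_def Un_ac)
    qed
    then have "components F = {F}" using x by auto
    moreover have "regions F = surface_faces F a0 a1 a2"
      by (simp add: region_steps_def surface_faces_def orbits2_eq_classes steps_def)
    moreover have "card F = 4 * card (surface_edges F a0 a1 a2)"
      using card_closed_eq_edges[of F] flagD by (simp add: surface_edges_eq edge_closed_def)
    ultimately show ?thesis using True by (simp add: euler_characteristic_def)
  next
    case False
    then obtain x where x: "x \<in> F - D" using edge_closedD(1)[OF D] by auto
    then have xF: "x \<in> F" by simp
    let ?D = "D \<union> edge_of x"
    have D': "edge_closed ?D" by (rule edge_closed_insert[OF D xF])
    have "D \<inter> edge_of x = {}" by (rule edge_of_disjoint[OF D x])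
    then have card: "card ?D = card D + 4"
      using card_edge_of[OF xF] edge_closedD(1)[OF D] finite_flags finite_subset[of D F]
      by (subst card_Un_disjoint) (auto simp: edge_of_def)
    have "card (F - ?D) < card (F - D)"
      using x finite_flags by (intro psubset_card_mono) (auto simp: edge_of_def)
    note IH = less.hyps[OF this D']
    note add = add_edge[OF D x]
    note comp = card_classes_insert_pair[OF sym_component_steps[OF D] finite_flags xF flagD(1)[OF xF]]
    note reg = card_classes_insert_pair[OF sym_region_steps[OF D'] finite_flags xF flagD(3)[OF xF]]
    have c: "components ?D = class_of (component_steps D \<union> {(x, a0 x), (a0 x, x)}) ` F"
      using add(1) by (simp add: class_of_def)
    have r: "regions D = class_of (region_steps ?D \<union> {(x, a2 x), (a2 x, x)}) ` F"
      using add(2) by (simp add: class_of_def)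
    show ?thesis
    proof (cases "(x, a0 x) \<in> (component_steps D)\<^sup>*")
      case True
      have "card (components D) = card (components ?D)" using comp(1)[OF True] c by simp
      moreover have "card (regions ?D) \<le> Suc (card (regions D))"
        using reg r by (cases "(x, a2 x) \<in> (region_steps ?D)\<^sup>*") auto
      ultimately show ?thesis using IH card by simp
    next
      case False
      have "card (components D) = Suc (card (components ?D))" using comp(2)[OF False] c by simp
      moreover have "card (regions D) = card (regions ?D)"
        using reg(1)[OF bridge_sides[OF D x False]] r by simp
      ultimately show ?thesis using IH card by simp
    qed
  qed
qed

section \<open>Sides of regions and edge counts in the skeleton\<close>

lemma region_closed:
  assumes "C \<in> regions D" "y \<in> C"
  shows "y \<in> F" "a0 y \<in> C" "a1 y \<in> C" "y \<notin> D \<Longrightarrow> a2 y \<in> C"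
proof -
  obtain x where x: "x \<in> F" "C = class_of (region_steps D) x" using assms(1) by auto
  have "class_of (region_steps D) x \<subseteq> F"
    by (rule class_of_subset[OF x(1)]) (auto simp: region_steps_def flagD)
  then show yF: "y \<in> F" using x assms(2) by auto
  show "a0 y \<in> C" "a1 y \<in> C" "y \<notin> D \<Longrightarrow> a2 y \<in> C"
    using rtrancl_into_rtrancl[of x y "region_steps D"] assms(2) x yF
    by (auto simp: mem_class_of region_steps_def)
qed

text \<open>By connectedness, a region that no \<open>a2\<close>-step leaves is the whole surface.
  This refutes regions with too few sides.\<close>

lemma region_eq_flags:
  assumes C: "C \<in> regions D" and "\<And>y. y \<in> C \<Longrightarrow> a2 y \<in> C"
  shows "C = F"
proof
  show "C \<subseteq> F" using region_closed(1)[OF C] by blast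
  obtain x where x: "x \<in> F" "x \<in> C" using C by auto
  let ?R = "steps F a0 \<union> steps F a1 \<union> steps F a2"
  have "class_of ?R x \<subseteq> C"
    by (rule class_of_subset[OF x(2)]) (use region_closed(2,3)[OF C] assms(2) in auto)
  then show "F \<subseteq> C"
    using connected[OF x(1)] by (auto simp: mem_class_of steps_def)
qed

text \<open>At a vertex, \<open>a1\<close> matches all flags of the region and \<open>a2\<close>
  matches those off \<open>D\<close>, so an even number remains on \<open>D\<close>: a boundary walk
  that enters a vertex must leave it. This replaces boundary walks altogether.\<close>

lemma even_region_flags_at_vertex:
  assumes D: "edge_closed D" and C: "C \<in> regions D"
  shows "even (card {y \<in> C \<inter> D. vertex_of y = v})"
proof -
  let ?X = "{y \<in> C. vertex_of y = v}"
  have CF: "C \<subseteq> F" using region_closed(1)[OF C] by blast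
  then have fin: "finite ?X" using finite_flags finite_subset[of C F] by simp
  have "even (card ?X)"
    by (rule even_card_involution[of _ a1])
      (use fin CF region_closed[OF C] flagD vertex_of_step in auto)
  moreover have "even (card (?X - D))"
  proof (rule even_card_involution[of _ a2])
    fix y assume y: "y \<in> ?X - D"
    then have yF: "y \<in> F" using CF by auto
    then show "a2 y \<in> ?X - D \<and> a2 (a2 y) = y \<and> a2 y \<noteq> y"
      using y region_closed(4)[OF C, of y] edge_closed_iff[OF D yF] flagD[OF yF] vertex_of_step[OF yF]
      by auto
  qed (use fin in auto)
  moreover have "card ?X = card (?X \<inter> D) + card (?X - D)" by (rule card_Int_Diff[OF fin])
  moreover have "?X \<inter> D = {y \<in> C \<inter> D. vertex_of y = v}" by auto
  ultimately show ?thesis by simp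
qed

context
  fixes D
  assumes D: "edge_closed D"
    and no_loops: "\<And>x. x \<in> D \<Longrightarrow> vertex_of (a0 x) \<noteq> vertex_of x"
    and no_parallels: "\<And>x y. x \<in> D \<Longrightarrow> y \<in> D \<Longrightarrow> vertex_of x = vertex_of y \<Longrightarrow>
      vertex_of (a0 x) = vertex_of (a0 y) \<Longrightarrow> y \<in> edge_of x"
    and card_D: "card D > 4"
begin

lemma subgraph_flag: "x \<in> D \<Longrightarrow> x \<in> F"
  using edge_closedD(1)[OF D] by blast

text \<open>
  A region bounded by at most two sides of edges would have a boundary walk of length two, which
  runs along both sides of one edge; then nothing else is attached to this edge.
\<close>

lemma region_card_ge_6:
  assumes C: "C \<in> regions D"
  shows "card (C \<inter> D) \<ge> 6"
proof (rule ccontr)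
  assume less: "\<not> card (C \<inter> D) \<ge> 6"
  let ?Y = "C \<inter> D"
  have fin: "finite ?Y" using edge_closedD(1)[OF D] finite_flags finite_subset by blast
  have Y_a0: "a0 y \<in> ?Y" if "y \<in> ?Y" for y
    using that region_closed(2)[OF C] edge_closedD(2)[OF D] by auto
  have not_a2_closed: False if a2: "\<And>y. y \<in> ?Y \<Longrightarrow> a2 y \<in> C"
  proof -
    have "C = F" by (rule region_eq_flags[OF C]) (use a2 region_closed(4)[OF C] in blast)
    then have "?Y = D" using edge_closedD(1)[OF D] by blast
    moreover have "even (card D)"
      by (rule even_card_involution[of _ a0])
        (use fin calculation edge_closedD[OF D] flagD subgraph_flag in auto)
    ultimately have "card D = 5 \<or> card D \<ge> 6 \<Longrightarrow> False" using less by auto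
    then show False using card_D by linarith
  qed
  \<comment> \<open>For empty \<open>?Y\<close> the premise of \<open>not_a2_closed\<close> holds
    vacuously, so \<open>?Y\<close> has a member.\<close>
  then obtain x where x: "x \<in> ?Y" by blast
  then have xD: "x \<in> D" and xF: "x \<in> F" using subgraph_flag by auto
  note xs = flagD[OF xF]
  have another: "\<exists>y\<in>?Y. y \<noteq> z \<and> vertex_of y = vertex_of z" if z: "z \<in> ?Y" for z
  proof (rule ccontr)
    assume "\<not> ?thesis"
    then have "{y \<in> ?Y. vertex_of y = vertex_of z} = {z}" using z by blast
    then show False using even_region_flags_at_vertex[OF D C, of "vertex_of z"] by simp
  qed
  obtain y where y: "y \<in> ?Y" "y \<noteq> x" "vertex_of y = vertex_of x" using another[OF x] by blast
  have yD: "y \<in> D" and yF: "y \<in> F" using y subgraph_flag by auto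
  note ys = flagD[OF yF]
  have neq: "y \<noteq> a0 x" "a0 y \<noteq> x" "a0 y \<noteq> a0 x"
    using y no_loops[OF xD] no_loops[OF yD] xs(4) ys(4) by metis+
  let ?S = "{x, a0 x, y, a0 y}"
  have card_S: "card ?S = 4" using neq y xs ys by auto
  have "even (card ?Y)"
    by (rule even_card_involution[of _ a0]) (use fin Y_a0 flagD subgraph_flag in auto)
  moreover have S: "?S \<subseteq> ?Y" using x y Y_a0 by simp
  then have "card ?S \<le> card ?Y" by (rule card_mono[OF fin])
  ultimately have "card ?Y = 4" using less card_S by presburger
  then have Y_eq: "?S = ?Y" using card_subset_eq[OF fin S] card_S by simp
  have "vertex_of (a0 y) = vertex_of (a0 x)"
  proof -
    obtain z where z: "z \<in> ?Y" "z \<noteq> a0 x" "vertex_of z = vertex_of (a0 x)"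
      using another[OF Y_a0[OF x]] by blast
    then have "z = a0 y" using y(3) no_loops[OF xD] unfolding Y_eq[symmetric] by auto
    then show ?thesis using z by simp
  qed
  then have "y \<in> edge_of x" using no_parallels[OF xD yD] y(3) by simp
  then have "y = a2 x \<or> y = a0 (a2 x)" using neq(1) y(2) by (simp add: edge_of_def)
  then have "?S = edge_of x"
    using flagD(4)[OF xs(3)] by (auto simp: edge_of_def)
  then have "edge_of x = ?Y" using Y_eq by simp
  then show False using not_a2_closed edge_of_closed(3)[OF xF] by blast
qed

text \<open>By \<open>a0\<close> the flags of \<open>C\<close> on \<open>D\<close> are matched
  across the bipartition, and each half is even because it is even at every vertex. Hence four
  divides their number, which improves six to eight.\<close>

lemma region_card_ge_8:
  assumes C: "C \<in> regions D"
    and bipartite: "\<And>x. x \<in> D \<Longrightarrow> vertex_of (a0 x) \<in> A \<longleftrightarrow> vertex_of x \<notin> A"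
  shows "card (C \<inter> D) \<ge> 8"
proof -
  let ?Y = "C \<inter> D"
  let ?Y1 = "{y \<in> ?Y. vertex_of y \<in> A}" and ?Y2 = "{y \<in> ?Y. vertex_of y \<notin> A}"
  have fin: "finite ?Y" using edge_closedD(1)[OF D] finite_flags finite_subset by blast
  have Y_a0: "a0 y \<in> ?Y" if "y \<in> ?Y" for y
    using that region_closed(2)[OF C] edge_closedD(2)[OF D] by auto
  have "bij_betw a0 ?Y1 ?Y2"
    by (rule bij_betw_byWitness[of _ a0]) (use Y_a0 bipartite flagD subgraph_flag in auto)
  then have "card ?Y1 = card ?Y2" by (rule bij_betw_same_card)
  moreover have "card ?Y = card ?Y1 + card ?Y2"
  proof -
    have "?Y \<inter> {y. vertex_of y \<in> A} = ?Y1" "?Y - {y. vertex_of y \<in> A} = ?Y2" by auto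
    then show ?thesis using card_Int_Diff[OF fin, of "{y. vertex_of y \<in> A}"] by simp
  qed
  moreover have "even (card ?Y1)"
  proof -
    have "card {y \<in> ?Y1. vertex_of y = v} = card {y \<in> ?Y. vertex_of y = v}"
      if "v \<in> vertex_of ` ?Y1" for v
      using that by (intro arg_cong[where f = card]) auto
    then have "even (card {y \<in> ?Y1. vertex_of y = v})" if "v \<in> vertex_of ` ?Y1" for v
      using that even_region_flags_at_vertex[OF D C] by simp
    then have "even (\<Sum>v\<in>vertex_of ` ?Y1. card {y \<in> ?Y1. vertex_of y = v})" by (rule dvd_sum)
    moreover have "finite ?Y1" by (rule finite_subset[OF _ fin]) auto
    ultimately show ?thesis by (simp only: card_eq_sum_fibres[of ?Y1 vertex_of])
  qed
  ultimately have "4 dvd card ?Y" by auto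
  then show ?thesis using region_card_ge_6[OF C] by presburger
qed

text \<open>Skeleton vertices outside \<open>W\<close> are components of their own, and the edges of
  \<open>D\<close> lie in yet another one. The strictness pays for the \<open>- 1\<close> beside the
  component count in the Euler inequality, so further skeleton vertices do not weaken the
  bounds.\<close>

lemma card_components_ge:
  assumes W: "W \<subseteq> surface_vertices F a0 a1 a2" and DW: "\<And>x. x \<in> D \<Longrightarrow> vertex_of x \<in> W"
  shows "card (surface_vertices F a0 a1 a2) < card (components D) + card W"
proof -
  let ?V = "surface_vertices F a0 a1 a2"
  have finV: "finite ?V" using finite_flags by (simp add: surface_vertices_eq)
  have isolated: "vertex_of x = class_of (component_steps D) x" if "x \<in> F" "vertex_of x \<notin> W" for x
  proof
    show "vertex_of x \<subseteq> class_of (component_steps D) x"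
      using rtrancl_mono[of "steps F a1 \<union> steps F a2" "component_steps D"]
      by (auto simp: vertex_of_def class_of_def component_steps_def)
    show "class_of (component_steps D) x \<subseteq> vertex_of x"
    proof (rule class_of_subset)
      fix y z assume yz: "(y, z) \<in> component_steps D" "y \<in> vertex_of x"
      have y: "y \<in> F" "vertex_of y = vertex_of x"
        using vertex_of_eq[of "vertex_of x" y] yz that by (auto simp: surface_vertices_eq)
      then have "y \<notin> D" using DW that by metis
      then have "vertex_of z = vertex_of x"
        using yz y vertex_of_step[OF y(1)] by (auto simp: component_steps_def)
      then show "z \<in> vertex_of x" using class_of_refl[of z] by (metis vertex_of_def)
    qed (simp add: vertex_of_def)
  qed
  obtain d where d: "d \<in> D" using card_D by fastforce
  let ?c = "class_of (component_steps D) d"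
  have "?c \<notin> ?V - W"
    using vertex_of_eq(2)[of ?c d] DW[OF d] by auto
  then have "card (?V - W) + 1 = card (insert ?c (?V - W))" using finV by simp
  also have "\<dots> \<le> card (components D)"
    by (rule card_mono) (use finite_flags isolated subgraph_flag[OF d] in \<open>auto simp: surface_vertices_eq\<close>)
  finally show ?thesis using card_Diff_subset[OF finite_subset[OF W finV] W] card_mono[OF finV W] by simp
qed

lemma card_regions_le:
  assumes "\<And>C. C \<in> regions D \<Longrightarrow> card (C \<inter> D) \<ge> m"
  shows "m * card (regions D) \<le> card D"
proof -
  have fin: "finite D" using edge_closedD(1)[OF D] finite_flags finite_subset by blast
  let ?cl = "class_of (region_steps D)"
  have eq: "{x \<in> D. ?cl x = C} = C \<inter> D" if C: "C \<in> regions D" for C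
  proof -
    obtain x where x: "C = ?cl x" using C by blast
    have "?cl y = C \<longleftrightarrow> y \<in> C" for y
      using class_of_eq_iff[OF sym_region_steps[OF D], of x y] x by (auto simp: mem_class_of)
    then show ?thesis by auto
  qed
  have "card D = (\<Sum>C\<in>regions D. card {x \<in> D. ?cl x = C})"
    using sum.group[OF fin, of "regions D" ?cl "\<lambda>_. 1::nat"] finite_flags subgraph_flag by fastforce
  also have "\<dots> = (\<Sum>C\<in>regions D. card (C \<inter> D))" using eq by (intro sum.cong) auto
  also have "\<dots> \<ge> (\<Sum>C\<in>regions D. m)" by (rule sum_mono) (rule assms)
  finally show ?thesis by (simp add: mult.commute)
qed

text \<open>In the Euler inequality, vertices minus components plus one are at most
  \<open>card W\<close>, and six flags per region leave a third of \<open>card D\<close>; hence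
  \<open>12 = 3 * 4\<close>.\<close>

lemma simple_skeleton_bound:
  assumes "W \<subseteq> surface_vertices F a0 a1 a2" "\<And>x. x \<in> D \<Longrightarrow> vertex_of x \<in> W"
  shows "int (card D) \<le> 12 * (int (card W) - euler_characteristic F a0 a1 a2)"
  using subgraph_euler_inequality[OF D] card_components_ge[OF assms]
    card_regions_le[of 6] region_card_ge_6 by force

text \<open>Eight flags per region leave half of \<open>card D\<close>; hence
  \<open>8 = 2 * 4\<close>.\<close>

lemma bipartite_skeleton_bound:
  assumes "W \<subseteq> surface_vertices F a0 a1 a2" "\<And>x. x \<in> D \<Longrightarrow> vertex_of x \<in> W"
    and "\<And>x. x \<in> D \<Longrightarrow> vertex_of (a0 x) \<in> A \<longleftrightarrow> vertex_of x \<notin> A"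
  shows "int (card D) \<le> 8 * (int (card W) - euler_characteristic F a0 a1 a2)"
  using subgraph_euler_inequality[OF D] card_components_ge[OF assms(1,2)]
    card_regions_le[of 8] region_card_ge_8[OF _ assms(3)] by force

end

end

subsection \<open>Edge bounds for graphs of bounded Euler genus\<close>

text \<open>The infimum is attained because \<open>enat\<close> is well-ordered; a finite bound
  excludes the empty set, whose infimum is infinite.\<close>

lemma Inf_enat_le_imp:
  assumes "Inf {enat n | n. P n} \<le> enat m"
  shows "\<exists>n\<le>m. P n"
proof -
  define S where "S = {enat n | n. P n}"
  have "S \<noteq> {}" using assms unfolding S_def[symmetric] by (auto simp: Inf_enat_def)
  then obtain a where "a \<in> S" by blast
  then have "Inf S \<in> S" by (rule wellorder_InfI)
  then obtain n where "Inf S = enat n" "P n" by (auto simp: S_def)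
  then show ?thesis using assms unfolding S_def[symmetric] by auto
qed

text \<open>\<open>E\<close> consists of arcs, two per edge, so 6 and 4 are twice the usual 3 and 2;
  \<open>card E > 2\<close> means at least two edges, the case in which every region has three
  sides. \<open>W\<close> and \<open>E\<close> may form any subgraph of \<open>H\<close>, since the
  bounds are applied to pieces of a thickness decomposition.\<close>

lemma euler_genus_edge_bounds:
  assumes genus: "euler_genus H \<le> enat g" and EH: "E \<subseteq> parcs H" and WH: "W \<subseteq> pverts H"
    and EW: "E \<subseteq> W \<times> W" and fin: "finite W" and symE: "sym E" and irr: "irrefl E"
    and card_E: "card E > 2"
  shows "int (card E) \<le> 6 * (int (card W) + int g - 2)"
    and "(\<And>u v. (u, v) \<in> E \<Longrightarrow> u \<in> A \<longleftrightarrow> v \<notin> A) \<Longrightarrow>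
      int (card E) \<le> 4 * (int (card W) + int g - 2)"
proof -
  obtain g' and F :: "nat set" and a0 a1 a2 where g': "g' \<le> g" and cs: "cell_surface F a0 a1 a2"
    and sg: "surface_euler_genus F a0 a1 a2 = int g'" and emb: "embeds_in_surface H F a0 a1 a2"
    using Inf_enat_le_imp[OF genus[unfolded euler_genus_def]]
    by (elim exE conjE) (rule that; assumption)
  obtain f where inj: "inj_on f (pverts H)"
    and fV: "f ` pverts H \<subseteq> surface_vertices F a0 a1 a2"
    and fE: "\<forall>(u, v) \<in> parcs H. \<exists>x \<in> f u. a0 x \<in> f v"
    using emb unfolding embeds_in_surface_def by (elim exE conjE) (rule that; assumption)
  interpret cell_surface F a0 a1 a2 by (rule cs)
  have finE: "finite E" using EW fin finite_subset by blast
  let ?p = "\<lambda>(u, v). {u, v}"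
  define U where "U = ?p ` E"
  have "card {e \<in> E. ?p e = ?p e'} = 2" if e': "e' \<in> E" for e'
  proof -
    obtain u v where uv: "e' = (u, v)" by fastforce
    have E: "(u, v) \<in> E" "(v, u) \<in> E" using e' symD[OF symE] unfolding uv by auto
    have "{e \<in> E. ?p e = ?p e'} = {(u, v), (v, u)}"
    proof (intro equalityI subsetI)
      fix e assume "e \<in> {e \<in> E. ?p e = ?p e'}"
      moreover obtain a b where "e = (a, b)" by fastforce
      ultimately show "e \<in> {(u, v), (v, u)}" using uv by (simp add: doubleton_eq_iff)
    next
      fix e assume "e \<in> {(u, v), (v, u)}"
      then show "e \<in> {e \<in> E. ?p e = ?p e'}" using uv E by (auto simp: insert_commute)
    qed
    moreover have "u \<noteq> v" using E irr by (auto simp: irrefl_def)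
    ultimately show ?thesis by simp
  qed
  from card_eq_mult_fibres[OF finE this] have card_U: "card E = 2 * card U" by (simp add: U_def)
  define ends where "ends x = {vertex_of x, vertex_of (a0 x)}" for x
  have "\<exists>x. x \<in> F \<and> ends x = f ` s" if s: "s \<in> U" for s
  proof -
    obtain u v where uv: "s = {u, v}" "(u, v) \<in> E" using s by (auto simp: U_def)
    then obtain x where x: "x \<in> f u" "a0 x \<in> f v" using fE EH by fast
    have "f u \<in> surface_vertices F a0 a1 a2" "f v \<in> surface_vertices F a0 a1 a2"
      using uv EW WH fV by blast+
    then have "x \<in> F" "vertex_of x = f u" "vertex_of (a0 x) = f v" using vertex_of_eq x by blast+
    then show ?thesis using uv by (auto simp: ends_def)
  qed
  \<comment> \<open>The skeleton may join the same ends several times; fixing one skeleton edge per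
    edge of the graph makes the chosen subgraph simple.\<close>
  then obtain sel where sel: "\<And>s. s \<in> U \<Longrightarrow> sel s \<in> F \<and> ends (sel s) = f ` s" by metis
  have ends_edge: "ends y = ends x" if "x \<in> F" "y \<in> edge_of x" for x y
    using that flagD[OF that(1)] vertex_of_step[OF that(1)] vertex_of_step[OF flagD(1)[OF that(1)]]
      flagD[OF flagD(3)[OF that(1)]]
    by (auto simp: edge_of_def ends_def insert_commute)
  define D where "D = (\<Union>s\<in>U. edge_of (sel s))"
  have closed_D: "edge_closed D"
    unfolding edge_closed_def
  proof (intro conjI subsetI ballI)
    fix x assume "x \<in> D"
    then obtain s where s: "s \<in> U" "x \<in> edge_of (sel s)" by (auto simp: D_def)
    then have "x \<in> F" "a0 x \<in> edge_of (sel s)" "a2 x \<in> edge_of (sel s)"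
      using edge_of_closed(1-3)[OF conjunct1[OF sel[OF s(1)]] s(2)] by auto
    then show "x \<in> F" "a0 x \<in> D" "a2 x \<in> D" using s(1) by (auto simp: D_def)
  qed
  have D_cases: "\<exists>s\<in>U. edge_of x = edge_of (sel s) \<and> ends x = f ` s" if x: "x \<in> D" for x
  proof -
    obtain s where s: "s \<in> U" "x \<in> edge_of (sel s)" using x by (auto simp: D_def)
    then have "edge_of x = edge_of (sel s)" "ends x = f ` s"
      using sel[OF s(1)] ends_edge[OF _ s(2)] edge_of_closed(4)[OF _ s(2)] by auto
    then show ?thesis using s(1) by blast
  qed
  have U_W: "s \<subseteq> W" if "s \<in> U" for s using that EW by (auto simp: U_def)
  have U_inj: "s = t" if "s \<in> U" "t \<in> U" "f ` s = f ` t" for s t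
    using inj_on_image_eq_iff[OF inj] that U_W WH by (meson order_trans)
  have "inj_on (\<lambda>s. edge_of (sel s)) U"
  proof (rule inj_onI)
    fix s t assume st: "s \<in> U" "t \<in> U" "edge_of (sel s) = edge_of (sel t)"
    then have "ends (sel s) = ends (sel t)" using sel ends_edge edge_of_refl by metis
    then show "s = t" using st sel U_inj by metis
  qed
  moreover have "edge_of ` D = (\<lambda>s. edge_of (sel s)) ` U"
    using D_cases by (force simp: D_def)
  ultimately have card_D: "card D = 4 * card U"
    using card_closed_eq_edges[OF closed_D] by (simp add: card_image)
  have DE: "int (card D) = 2 * int (card E)" using card_D card_U by simp
  have no_loops: "vertex_of (a0 x) \<noteq> vertex_of x" if x: "x \<in> D" for x
  proof
    assume eq: "vertex_of (a0 x) = vertex_of x"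
    obtain s where s: "s \<in> U" "ends x = f ` s" using D_cases[OF x] by blast
    then obtain u v where uv: "s = {u, v}" "(u, v) \<in> E" by (auto simp: U_def)
    then have "f u = f v" using s eq by (auto simp: ends_def)
    then have "u = v" using inj uv EW WH by (blast dest: inj_onD)
    then show False using uv irr by (auto simp: irrefl_def)
  qed
  have no_parallels: "y \<in> edge_of x" if "x \<in> D" "y \<in> D" "vertex_of x = vertex_of y"
    "vertex_of (a0 x) = vertex_of (a0 y)" for x y
  proof -
    have "ends x = ends y" using that by (simp add: ends_def)
    then have "edge_of x = edge_of y" using D_cases[OF that(1)] D_cases[OF that(2)] U_inj by metis
    then show ?thesis by simp
  qed
  have gt: "card D > 4" using card_D card_U card_E by simp
  have fW: "f ` W \<subseteq> surface_vertices F a0 a1 a2" using fV WH by blast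
  have DW: "vertex_of x \<in> f ` W" if x: "x \<in> D" for x
  proof -
    obtain s where s: "s \<in> U" "ends x = f ` s" using D_cases[OF x] by blast
    have "vertex_of x \<in> ends x" by (simp add: ends_def)
    then show ?thesis using s U_W[OF s(1)] by auto
  qed
  have card_W: "card (f ` W) = card W" using inj_on_subset[OF inj WH] by (rule card_image)
  have chi: "euler_characteristic F a0 a1 a2 \<ge> 2 - int g"
    using sg g' by (simp add: surface_euler_genus_def)
  show "int (card E) \<le> 6 * (int (card W) + int g - 2)"
  proof -
    have "int (card D) \<le> 12 * (int (card (f ` W)) - euler_characteristic F a0 a1 a2)"
      by (rule simple_skeleton_bound[OF closed_D no_loops no_parallels gt fW DW])
    then show ?thesis using DE chi by (simp add: card_W)
  qed
  assume bip: "\<And>u v. (u, v) \<in> E \<Longrightarrow> u \<in> A \<longleftrightarrow> v \<notin> A"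
  have "vertex_of (a0 x) \<in> f ` (A \<inter> W) \<longleftrightarrow> vertex_of x \<notin> f ` (A \<inter> W)" if x: "x \<in> D" for x
  proof -
    obtain s where s: "s \<in> U" "ends x = f ` s" using D_cases[OF x] by blast
    then obtain u v where uv: "s = {u, v}" "(u, v) \<in> E" by (auto simp: U_def)
    have W: "u \<in> W" "v \<in> W" using uv EW by auto
    have iff: "f w \<in> f ` (A \<inter> W) \<longleftrightarrow> w \<in> A" if "w \<in> W" for w
      using that inj_on_image_mem_iff[OF inj_on_subset[OF inj WH], of w "A \<inter> W"] by auto
    have "vertex_of x = f u \<and> vertex_of (a0 x) = f v \<or> vertex_of x = f v \<and> vertex_of (a0 x) = f u"
      using s uv by (auto simp: ends_def doubleton_eq_iff)
    then show ?thesis using iff[OF W(1)] iff[OF W(2)] bip[OF uv(2)] by metis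
  qed
  with closed_D no_loops no_parallels gt fW DW
  have "int (card D) \<le> 8 * (int (card (f ` W)) - euler_characteristic F a0 a1 a2)"
    by (rule bipartite_skeleton_bound)
  then show "int (card E) \<le> 4 * (int (card W) + int g - 2)"
    using DE chi by (simp add: card_W)
qed

lemma pair_graphD:
  assumes "pair_graph G"
  shows "finite (pverts G)" "finite (parcs G)" "sym (parcs G)" "irrefl (parcs G)"
    "parcs G \<subseteq> pverts G \<times> pverts G"
proof -
  interpret pair_graph G by (rule assms)
  show "finite (pverts G)" "finite (parcs G)" by auto
  show "sym (parcs G)" by (rule symI) (rule arcs_symmetric)
  show "irrefl (parcs G)" using no_loops' by (auto simp: irrefl_def)
  show "parcs G \<subseteq> pverts G \<times> pverts G" by (auto dest: in_arcsD1 in_arcsD2)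
qed

section \<open>Edge bounds and light edges for bounded thickness\<close>

lemma thickness_edge_bound_aux:
  assumes finV: "finite V" and "card V \<ge> 3" and EV: "E \<subseteq> V \<times> V"
    and cover: "E \<subseteq> (\<Union>i<k'. parcs (H i))" and "k' \<le> k"
    and part: "\<And>i. i < k' \<Longrightarrow> card (E \<inter> parcs (H i)) > 2 \<Longrightarrow>
      int (card (E \<inter> parcs (H i))) \<le> c * (int (card (V \<inter> pverts (H i))) + int g - 2)"
    and "c \<ge> 2"
  shows "int (card E) \<le> c * int k * (int (card V) + int g - 2)"
proof -
  let ?b = "c * (int (card V) + int g - 2)"
  have finE: "finite E" using EV finV finite_subset by blast
  have "int (card (E \<inter> parcs (H i))) \<le> ?b" if i: "i < k'" for i
  proof (cases "card (E \<inter> parcs (H i)) > 2")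
    case True
    have "card (V \<inter> pverts (H i)) \<le> card V" using finV by (intro card_mono) auto
    then have "c * (int (card (V \<inter> pverts (H i))) + int g - 2) \<le> ?b"
      using \<open>c \<ge> 2\<close> by (intro mult_left_mono) auto
    then show ?thesis using part[OF i True] by linarith
  next
    case False
    \<comment> \<open>The bound \<open>part\<close> says nothing about pieces with at most two arcs,
      but \<open>card V \<ge> 3\<close> makes the target at least two.\<close>
    have "2 * 1 \<le> ?b" using assms(2) \<open>c \<ge> 2\<close> by (intro mult_mono) auto
    then show ?thesis using False by linarith
  qed
  then have "(\<Sum>i<k'. int (card (E \<inter> parcs (H i)))) \<le> (\<Sum>i<k'. ?b)"
    by (intro sum_mono) auto
  also have "\<dots> = int k' * ?b" by simp
  also have "\<dots> \<le> int k * ?b"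
    using \<open>k' \<le> k\<close> assms(2) \<open>c \<ge> 2\<close> by (intro mult_right_mono) auto
  finally have "(\<Sum>i<k'. int (card (E \<inter> parcs (H i)))) \<le> int k * ?b" .
  moreover have "card E \<le> (\<Sum>i<k'. card (E \<inter> parcs (H i)))"
  proof -
    have "E = (\<Union>i<k'. E \<inter> parcs (H i))" using cover by auto
    then show ?thesis using card_UN_le[of "{..<k'}" "\<lambda>i. E \<inter> parcs (H i)"] by simp
  qed
  then have "int (card E) \<le> (\<Sum>i<k'. int (card (E \<inter> parcs (H i))))"
    by (simp flip: of_nat_sum)
  ultimately show ?thesis by (simp add: algebra_simps)
qed

lemma thickness_edge_bounds:
  assumes thick: "g_thickness g G \<le> enat k" and EG: "E \<subseteq> parcs G"
    and finV: "finite V" and cardV: "card V \<ge> 3" and EV: "E \<subseteq> V \<times> V" and symE: "sym E"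
  shows "int (card E) \<le> 6 * int k * (int (card V) + int g - 2)"
    and "(\<And>u v. (u, v) \<in> E \<Longrightarrow> u \<in> A \<longleftrightarrow> v \<notin> A) \<Longrightarrow>
      int (card E) \<le> 4 * int k * (int (card V) + int g - 2)"
proof -
  obtain k' and H :: "nat \<Rightarrow> 'a pair_pre_digraph" where k': "k' \<le> k"
    and H: "\<forall>i<k'. pair_graph (H i) \<and> subgraph (with_proj (H i)) (with_proj G) \<and>
                   euler_genus (H i) \<le> enat g"
    and cover: "pverts G = (\<Union>i<k'. pverts (H i)) \<and> parcs G = (\<Union>i<k'. parcs (H i))"
    using Inf_enat_le_imp[OF thick[unfolded g_thickness_def]]
    by (elim exE conjE) (rule that; (assumption | intro conjI; assumption))
  have graph: "pair_graph (H i)" and genus: "euler_genus (H i) \<le> enat g" if "i < k'" for i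
    using H that by auto
  have EH: "E \<subseteq> (\<Union>i<k'. parcs (H i))" using EG cover by simp
  have sub: "E \<inter> parcs (H i) \<subseteq> (V \<inter> pverts (H i)) \<times> (V \<inter> pverts (H i))" if "i < k'" for i
    using EV pair_graphD(5)[OF graph[OF that]] by blast
  have symH: "sym (E \<inter> parcs (H i))" if "i < k'" for i
    using symE pair_graphD(3)[OF graph[OF that]] by (rule sym_Int)
  have irrH: "irrefl (E \<inter> parcs (H i))" if "i < k'" for i
    using pair_graphD(4)[OF graph[OF that]] by (auto simp: irrefl_def)
  note bounds = euler_genus_edge_bounds[OF genus Int_lower2 Int_lower2 sub _ symH irrH]
  show "int (card E) \<le> 6 * int k * (int (card V) + int g - 2)"
    by (rule thickness_edge_bound_aux[OF finV cardV EV EH k'])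
      (use bounds(1) finV in auto)
  assume bip: "\<And>u v. (u, v) \<in> E \<Longrightarrow> u \<in> A \<longleftrightarrow> v \<notin> A"
  show "int (card E) \<le> 4 * int k * (int (card V) + int g - 2)"
  proof (rule thickness_edge_bound_aux[OF finV cardV EV EH k'])
    fix i assume i: "i < k'" and gt: "card (E \<inter> parcs (H i)) > 2"
    show "int (card (E \<inter> parcs (H i))) \<le> 4 * (int (card (V \<inter> pverts (H i))) + int g - 2)"
      by (rule bounds(2)[where A = A]) (use i gt finV bip in auto)
  qed simp
qed

text \<open>Here \<open>a\<close> and \<open>b\<close> count the vertices of low and high degree.
  Substituting \<open>a \<le> 2 * k * (b + g - 2)\<close> into the total degree gives
  \<open>b + g - 2\<close> the coefficient
  \<open>2 * k * (4 * k - 1) + 6 * k = 8 * k^2 + 4 * k\<close>, which \<open>l\<close> contains in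
  order to cancel the part with \<open>b\<close>. The rest of \<open>l + 1\<close> is
  \<open>2 * k * g + 1\<close>; against \<open>b \<ge> 4 * k + 2\<close> it beats \<open>g\<close>
  copies of that coefficient, as \<open>2 * k * (4 * k + 2)\<close> equals it.\<close>

lemma light_edge_arith:
  fixes a b g k l :: int
  assumes "k \<ge> 1" "a \<ge> 0" "g \<ge> 0"
    and l: "l = 2 * k * g + 8 * k\<^sup>2 + 4 * k"
    and low: "(2 * k + 1) * a \<le> 2 * k * (a + b + g - 2)"
    and high: "l + 1 \<le> a + b - 1"
    and total: "(2 * k + 1) * a + (l + 1) * b \<le> 6 * k * (a + b + g - 2)"
  shows False
proof -
  have a: "a \<le> 2 * k * (b + g - 2)" using low by (simp add: algebra_simps)
  \<comment> \<open>\<open>high\<close> and the bound on \<open>a\<close> give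
    \<open>(2 * k + 1) * b \<ge> l + 2 - 2 * k * (g - 2)\<close>, whose right-hand side is exactly
    \<open>2 * (2 * k + 1)^2\<close>.\<close>
  have "(2 * k + 1) * (4 * k + 2) \<le> (2 * k + 1) * b"
    using a high by (simp add: l algebra_simps power2_eq_square)
  then have b: "4 * k + 2 \<le> b" using assms(1) by simp
  have "(l + 1) * b \<le> (4 * k - 1) * a + 6 * k * (b + g - 2)"
    using total by (simp add: algebra_simps)
  also have "\<dots> \<le> (4 * k - 1) * (2 * k * (b + g - 2)) + 6 * k * (b + g - 2)"
    using a assms(1) by (intro add_right_mono mult_left_mono) auto
  also have "\<dots> = (8 * k\<^sup>2 + 4 * k) * (b + g - 2)"
    by (simp add: algebra_simps power2_eq_square)
  finally have 1: "(2 * k * g + 1) * b \<le> (8 * k\<^sup>2 + 4 * k) * (g - 2)"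
    by (simp add: l algebra_simps)
  have "(2 * k * g + 1) * (4 * k + 2) \<le> (2 * k * g + 1) * b"
    using b assms by (intro mult_left_mono) auto
  with 1 have "4 * k + 2 + 2 * (8 * k\<^sup>2 + 4 * k) \<le> 0"
    by (simp add: algebra_simps power2_eq_square)
  moreover have "0 < 4 * k + 2 + 2 * (8 * k\<^sup>2 + 4 * k)"
    using assms(1) by (intro add_pos_nonneg mult_nonneg_nonneg add_nonneg_nonneg) auto
  ultimately show False by simp
qed

text \<open>
  Let \<open>A\<close> and \<open>B\<close> be the vertices of low and high degree. If no edge joins two vertices of \<open>A\<close>,
  then the bipartite graph between \<open>A\<close> and \<open>B\<close> has at least \<open>(2k + 1)|A|\<close> edges, which bounds
  \<open>|A|\<close> linearly in \<open>|B|\<close>, and the total degree is too large.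
\<close>

lemma thickness_light_edge:
  assumes thick: "g_thickness g G \<le> enat k" and EG: "E \<subseteq> parcs G" and irr: "irrefl E"
    and finV: "finite V" and EV: "E \<subseteq> V \<times> V" and symE: "sym E"
    and V: "V \<noteq> {}" and k: "k \<ge> 1" and deg: "\<And>v. v \<in> V \<Longrightarrow> card (E `` {v}) \<ge> 2 * k + 1"
    and l: "l = 2 * k * g + 8 * k\<^sup>2 + 4 * k"
  shows "\<exists>(u, v) \<in> E. card (E `` {u}) \<le> l \<and> card (E `` {v}) \<le> l"
proof (rule ccontr)
  assume no_light: "\<not> ?thesis"
  define A where "A = {v \<in> V. card (E `` {v}) \<le> l}"
  define B where "B = V - A"
  have finE: "finite E" using EV finV finite_subset by blast
  have fin: "finite A" "finite B" using finV by (auto simp: A_def B_def)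
  have cardAB: "card V = card A + card B"
    using card_Un_disjoint[OF fin] by (auto simp: A_def B_def Un_absorb1)
  have degree_sum: "(\<Sum>v\<in>X. card (E `` {v})) = card (E \<inter> X \<times> UNIV)" if "finite X" for X
  proof -
    have "E \<inter> X \<times> UNIV = Sigma X (\<lambda>v. E `` {v})" by auto
    moreover have "finite (E `` {v})" for v using finE by (rule finite_Image)
    ultimately show ?thesis using that by simp
  qed
  have nbrs: "card (E `` {v}) \<le> card V - 1" if "v \<in> V" for v
  proof -
    have "E `` {v} \<subseteq> V - {v}" using EV irr by (auto simp: irrefl_def)
    then have "card (E `` {v}) \<le> card (V - {v})" using finV by (intro card_mono) auto
    then show ?thesis using that by simp
  qed
  obtain v0 where v0: "v0 \<in> V" using V by blast
  have cardV: "card V \<ge> 3" using deg[OF v0] nbrs[OF v0] k by linarith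
  let ?E1 = "E \<inter> A \<times> UNIV"
  \<comment> \<open>The bipartite bound is for symmetric arc sets, so the arcs leaving
    \<open>A\<close> are joined with their reversals. Independence of \<open>A\<close> makes the two
    sets disjoint, which turns the constant 4 into 2.\<close>
  let ?EB = "?E1 \<union> ?E1\<inverse>"
  have A_indep: "v \<notin> A" if "(u, v) \<in> E" "u \<in> A" for u v
    using that no_light by (auto simp: A_def)
  have "(\<Sum>v\<in>A. 2 * k + 1) \<le> (\<Sum>v\<in>A. card (E `` {v}))"
    by (rule sum_mono) (use deg in \<open>auto simp: A_def\<close>)
  then have low: "(2 * k + 1) * card A \<le> card ?E1"
    using degree_sum[OF fin(1)] by (simp add: mult.commute)
  have "?EB \<subseteq> E" using symE by (auto simp: sym_def)
  then have "int (card ?EB) \<le> 4 * int k * (int (card V) + int g - 2)"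
    using A_indep EG EV symE
    by (intro thickness_edge_bounds(2)[OF thick _ finV cardV, where A = A])
      (auto simp: sym_def)
  moreover have "card ?EB = 2 * card ?E1"
  proof -
    have "?E1 \<inter> ?E1\<inverse> = {}" using A_indep by auto
    then have "card ?EB = card ?E1 + card (?E1\<inverse>)" using finE by (intro card_Un_disjoint) auto
    then show ?thesis by simp
  qed
  ultimately have E1: "int (card ?E1) \<le> 2 * int k * (int (card V) + int g - 2)" by simp
  have "E \<inter> V \<times> UNIV = E" using EV by auto
  then have "card E = (\<Sum>v\<in>V. card (E `` {v}))" using degree_sum[OF finV] by simp
  also have "\<dots> = (\<Sum>v\<in>A. card (E `` {v})) + (\<Sum>v\<in>B. card (E `` {v}))"
    using sum.union_disjoint[OF fin, of "\<lambda>v. card (E `` {v})"]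
    by (auto simp: A_def B_def Un_absorb1)
  also have "\<dots> \<ge> (2 * k + 1) * card A + (l + 1) * card B"
  proof (rule add_mono)
    show "(2 * k + 1) * card A \<le> (\<Sum>v\<in>A. card (E `` {v}))"
      using low degree_sum[OF fin(1)] by simp
    have "(\<Sum>v\<in>B. l + 1) \<le> (\<Sum>v\<in>B. card (E `` {v}))"
      by (rule sum_mono) (auto simp: A_def B_def)
    then show "(l + 1) * card B \<le> (\<Sum>v\<in>B. card (E `` {v}))" by (simp add: mult.commute)
  qed
  finally have total: "(2 * k + 1) * card A + (l + 1) * card B \<le> card E" .
  have E: "int (card E) \<le> 6 * int k * (int (card V) + int g - 2)"
    by (rule thickness_edge_bounds(1)[OF thick EG finV cardV EV symE])
  have "B \<noteq> {}"
  proof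
    assume "B = {}"
    then have "V \<subseteq> A" by (auto simp: B_def)
    then have "E = {}" using EV A_indep by blast
    then show False using deg[OF v0] by simp
  qed
  \<comment> \<open>A single vertex of high degree forces many vertices in all; this supplies
    \<open>high\<close> for the arithmetic.\<close>
  then obtain w where "w \<in> B" by blast
  then have "w \<in> V" "card (E `` {w}) > l" by (auto simp: A_def B_def)
  then have high: "l + 1 \<le> card V - 1" using nbrs[of w] by linarith
  show False
  proof (rule light_edge_arith[of "int k" "int (card A)" "int g" "int l" "int (card B)"])
    have "int ((2 * k + 1) * card A) \<le> int (card ?E1)" using low by (simp only: of_nat_le_iff)
    then show "(2 * int k + 1) * int (card A)
        \<le> 2 * int k * (int (card A) + int (card B) + int g - 2)"
      using E1 cardAB by (simp add: distrib_right)
    show "int l + 1 \<le> int (card A) + int (card B) - 1" using high cardAB cardV by linarith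
    have "int ((2 * k + 1) * card A + (l + 1) * card B) \<le> int (card E)"
      using total by (simp only: of_nat_le_iff)
    then show "(2 * int k + 1) * int (card A) + (int l + 1) * int (card B)
        \<le> 6 * int k * (int (card A) + int (card B) + int g - 2)"
      using E cardAB by (simp add: distrib_right)
  qed (use k l in auto)
qed

subsection \<open>List colouring with defect\<close>

text \<open>Some colour of \<open>X\<close> is missing around \<open>u\<close>; giving it to
  \<open>u\<close> makes every edge at \<open>u\<close> bichromatic, so no other vertex gains a
  neighbour of its own colour.\<close>

lemma recolour:
  assumes "finite E" "sym E" "irrefl E" "card (c ` (E `` {u})) < card X"
  shows "\<exists>x\<in>X. {w. (u, w) \<in> E \<and> (c(u := x)) w = (c(u := x)) u} = {} \<and>
    (\<forall>v. v \<noteq> u \<longrightarrow> {w. (v, w) \<in> E \<and> (c(u := x)) w = (c(u := x)) v}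
      \<subseteq> {w. (v, w) \<in> E \<and> w \<noteq> u \<and> c w = c v})"
proof -
  have "finite (c ` (E `` {u}))" using assms(1) by (intro finite_imageI finite_Image)
  then have "\<not> X \<subseteq> c ` (E `` {u})" using card_mono[of "c ` (E `` {u})" X] assms(4) by auto
  then obtain x where x: "x \<in> X" "x \<notin> c ` (E `` {u})" by blast
  have "c w \<noteq> x" if "(u, w) \<in> E" for w using x that by auto
  moreover have "(u, v) \<in> E" if "(v, u) \<in> E" for v using symD[OF assms(2) that] .
  moreover have "(u, u) \<notin> E" using assms(3) by (auto simp: irrefl_def)
  ultimately show ?thesis using x(1) by (intro bexI[of _ x]) auto
qed

text \<open>Edges are deleted as well as vertices, so \<open>light\<close> is required for all
  subgraphs and not only for induced ones. The threshold \<open>d + m\<close> is chosen for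
  recolouring: more than \<open>d\<close> neighbours of the same colour leave at most
  \<open>m - 1\<close> others, hence at most \<open>m\<close> colours around the vertex.\<close>

lemma light_edge_colouring:
  assumes light: "\<And>V' E'. V' \<subseteq> V \<Longrightarrow> E' \<subseteq> E \<Longrightarrow> E' \<subseteq> V' \<times> V' \<Longrightarrow> sym E' \<Longrightarrow> V' \<noteq> {} \<Longrightarrow>
      (\<exists>v\<in>V'. card (E' `` {v}) \<le> m) \<or>
      (\<exists>(u, v)\<in>E'. card (E' `` {u}) \<le> d + m \<and> card (E' `` {v}) \<le> d + m)"
    and "finite V" "irrefl E" "E \<subseteq> V \<times> V" "sym E"
    and L: "\<And>v. v \<in> V \<Longrightarrow> card (L v) = Suc m"
  shows "\<exists>c. (\<forall>v\<in>V. c v \<in> L v) \<and> (\<forall>v\<in>V. card {w. (v, w) \<in> E \<and> c w = c v} \<le> d)"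
  using assms
proof (induction "card V + card E" arbitrary: V E rule: less_induct)
  case less
  note finV = less.prems(2) and irr = less.prems(3)
    and EV = less.prems(4) and symE = less.prems(5) and L = less.prems(6)
  have finE: "finite E" using EV finV finite_subset by blast
  have irr': "irrefl E'" if "E' \<subseteq> E" for E' using irr that by (auto simp: irrefl_def)
  have fin_nb: "finite {w. (v, w) \<in> E \<and> P w}" for v P
    by (rule finite_subset[OF _ finite_Image[OF finE, of "{v}"]]) auto
  show ?case
  proof (cases "V = {}")
    case False
    consider (vertex) v where "v \<in> V" "card (E `` {v}) \<le> m"
      | (edge) u v where "(u, v) \<in> E" "card (E `` {u}) \<le> d + m" "card (E `` {v}) \<le> d + m"
      using less.prems(1)[OF order_refl order_refl EV symE False] by blast
    then show ?thesis
    proof cases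
      case vertex
      let ?V = "V - {v}" and ?E = "E \<inter> (V - {v}) \<times> (V - {v})"
      have "card ?V < card V" using vertex(1) finV by (intro psubset_card_mono) auto
      moreover have "card ?E \<le> card E" using finE by (intro card_mono) auto
      ultimately have smaller: "card ?V + card ?E < card V + card E" by linarith
      have "\<exists>c. (\<forall>v\<in>?V. c v \<in> L v) \<and> (\<forall>v\<in>?V. card {w. (v, w) \<in> ?E \<and> c w = c v} \<le> d)"
      proof (rule less.hyps[OF smaller])
        show "sym ?E" using symE by (auto simp: sym_def)
        fix V' E' assume "V' \<subseteq> ?V" "E' \<subseteq> ?E" and *: "E' \<subseteq> V' \<times> V'" "sym E'" "V' \<noteq> {}"
        then have "V' \<subseteq> V" "E' \<subseteq> E" by auto
        then show "(\<exists>v\<in>V'. card (E' `` {v}) \<le> m) \<or>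
          (\<exists>(u, v)\<in>E'. card (E' `` {u}) \<le> d + m \<and> card (E' `` {v}) \<le> d + m)"
          using less.prems(1) * by blast
      qed (use finV irr' L in auto)
      then obtain c where c: "\<And>w. w \<in> ?V \<Longrightarrow> c w \<in> L w"
        "\<And>u. u \<in> ?V \<Longrightarrow> card {w. (u, w) \<in> ?E \<and> c w = c u} \<le> d" by blast
      have "card (c ` (E `` {v})) \<le> m"
        using card_image_le[OF finite_Image[OF finE], of c "{v}"] vertex(2) by simp
      then have "card (c ` (E `` {v})) < card (L v)" using L[OF vertex(1)] by simp
      then obtain x where x: "x \<in> L v" "{w. (v, w) \<in> E \<and> (c(v := x)) w = (c(v := x)) v} = {}"
        "\<And>u. u \<noteq> v \<Longrightarrow> {w. (u, w) \<in> E \<and> (c(v := x)) w = (c(v := x)) u}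
          \<subseteq> {w. (u, w) \<in> E \<and> w \<noteq> v \<and> c w = c u}"
        using recolour[OF finE symE irr] by blast
      have "card {w. (u, w) \<in> E \<and> (c(v := x)) w = (c(v := x)) u} \<le> d" if u: "u \<in> V" for u
      proof (cases "u = v")
        case True
        then show ?thesis using x(2) by (simp only: card.empty)
      next
        case False
        have "{w. (u, w) \<in> E \<and> w \<noteq> v \<and> c w = c u} \<subseteq> {w. (u, w) \<in> ?E \<and> c w = c u}"
          using False EV by auto
        with x(3)[OF False] have "{w. (u, w) \<in> E \<and> (c(v := x)) w = (c(v := x)) u}
            \<subseteq> {w. (u, w) \<in> ?E \<and> c w = c u}" by (rule subset_trans)
        then have "card {w. (u, w) \<in> E \<and> (c(v := x)) w = (c(v := x)) u}
            \<le> card {w. (u, w) \<in> ?E \<and> c w = c u}"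
          by (rule card_mono[rotated], intro finite_subset[OF _ fin_nb[of u "\<lambda>_. True"]]) auto
        also have "\<dots> \<le> d" using c(2) u False by simp
        finally show ?thesis .
      qed
      then show ?thesis using c(1) x(1) by (intro exI[of _ "c(v := x)"]) auto
    next
      case edge
      let ?E = "E - {(u, v), (v, u)}"
      have "card ?E < card E" using edge(1) finE by (intro psubset_card_mono) auto
      then have smaller: "card V + card ?E < card V + card E" by simp
      have uv: "u \<in> V" "v \<in> V" "u \<noteq> v" "(v, u) \<in> E"
        using edge(1) EV irr symD[OF symE] by (auto simp: irrefl_def)
      have "\<exists>c. (\<forall>v\<in>V. c v \<in> L v) \<and> (\<forall>v\<in>V. card {w. (v, w) \<in> ?E \<and> c w = c v} \<le> d)"
      proof (rule less.hyps[OF smaller])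
        show "sym ?E" using symE by (auto simp: sym_def)
        fix V' E' assume "V' \<subseteq> V" "E' \<subseteq> ?E" and *: "E' \<subseteq> V' \<times> V'" "sym E'" "V' \<noteq> {}"
        then have "V' \<subseteq> V" "E' \<subseteq> E" by auto
        then show "(\<exists>v\<in>V'. card (E' `` {v}) \<le> m) \<or>
          (\<exists>(u, v)\<in>E'. card (E' `` {u}) \<le> d + m \<and> card (E' `` {v}) \<le> d + m)"
          using less.prems(1) * by blast
      qed (use finV irr' L EV in auto)
      then obtain c where c: "\<And>w. w \<in> V \<Longrightarrow> c w \<in> L w"
        "\<And>u. u \<in> V \<Longrightarrow> card {w. (u, w) \<in> ?E \<and> c w = c u} \<le> d" by blast
      let ?M = "\<lambda>v. {w. (v, w) \<in> E \<and> c w = c v}"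
      \<comment> \<open>Only an end of the deleted edge can exceed the defect. Recolouring one such
        end also repairs the other, since the restored edge is then bichromatic.\<close>
      have rec: ?thesis if z: "z \<in> {u, v}" and big: "card (?M z) > d" for z
      proof -
        have zV: "z \<in> V" and dz: "card (E `` {z}) \<le> d + m" using z uv edge by auto
        have "c ` (E `` {z}) \<subseteq> insert (c z) (c ` (E `` {z} - ?M z))" by auto
        then have "card (c ` (E `` {z})) \<le> card (insert (c z) (c ` (E `` {z} - ?M z)))"
          using finE by (intro card_mono) (auto intro: finite_Image)
        also have "\<dots> \<le> Suc (card (c ` (E `` {z} - ?M z)))" by (rule card_insert_le_m1) auto
        also have "\<dots> \<le> Suc (card (E `` {z} - ?M z))"
          using finE by (simp add: card_image_le finite_Image)
        also have "card (E `` {z} - ?M z) = card (E `` {z}) - card (?M z)"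
          by (rule card_Diff_subset[OF fin_nb]) auto
        finally have "card (c ` (E `` {z})) \<le> Suc (card (E `` {z}) - card (?M z))" .
        moreover have "card (?M z) \<le> card (E `` {z})"
          by (rule card_mono[OF finite_Image[OF finE]]) auto
        ultimately have "card (c ` (E `` {z})) < card (L z)"
          using big dz L[OF zV] by linarith
        then obtain x where x: "x \<in> L z" "{w. (z, w) \<in> E \<and> (c(z := x)) w = (c(z := x)) z} = {}"
          "\<And>u. u \<noteq> z \<Longrightarrow> {w. (u, w) \<in> E \<and> (c(z := x)) w = (c(z := x)) u}
            \<subseteq> {w. (u, w) \<in> E \<and> w \<noteq> z \<and> c w = c u}"
          using recolour[OF finE symE irr] by blast
        have "card {w. (t, w) \<in> E \<and> (c(z := x)) w = (c(z := x)) t} \<le> d" if t: "t \<in> V" for t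
        proof (cases "t = z")
          case True
          then show ?thesis using x(2) by (simp only: card.empty)
        next
          case False
          have "{w. (t, w) \<in> E \<and> w \<noteq> z \<and> c w = c t} \<subseteq> {w. (t, w) \<in> ?E \<and> c w = c t}"
            using False z by auto
          with x(3)[OF False] have "{w. (t, w) \<in> E \<and> (c(z := x)) w = (c(z := x)) t}
              \<subseteq> {w. (t, w) \<in> ?E \<and> c w = c t}" by (rule subset_trans)
          then have "card {w. (t, w) \<in> E \<and> (c(z := x)) w = (c(z := x)) t}
              \<le> card {w. (t, w) \<in> ?E \<and> c w = c t}"
            by (rule card_mono[rotated], intro finite_subset[OF _ fin_nb[of t "\<lambda>_. True"]]) auto
          also have "\<dots> \<le> d" using c(2) t by simp
          finally show ?thesis .
        qed
        then show ?thesis using c(1) x(1) by (intro exI[of _ "c(z := x)"]) auto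
      qed
      show ?thesis
      proof (cases "card (?M u) > d \<or> card (?M v) > d")
        case True
        then show ?thesis using rec by blast
      next
        case False
        have "card (?M t) \<le> d" if t: "t \<in> V" for t
        proof (cases "t \<in> {u, v}")
          case True
          then show ?thesis using False by auto
        next
          case False
          then have "?M t = {w. (t, w) \<in> ?E \<and> c w = c t}" by auto
          then show ?thesis using c(2)[OF t] by simp
        qed
        then show ?thesis using c(1) by blast
      qed
    qed
  qed auto
qed

theorem thickness_defective_choosable:
  assumes k: "k \<ge> 1" and G: "pair_graph G" and thick: "g_thickness g G \<le> enat k"
  shows "defective_choosable (2 * k + 1) (2 * k * g + 8 * k\<^sup>2 + 2 * k) G"
proof -
  let ?d = "2 * k * g + 8 * k\<^sup>2 + 2 * k"
  have "\<exists>c. (\<forall>v\<in>pverts G. c v \<in> L v) \<and>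
      (\<forall>v\<in>pverts G. card {w. (v, w) \<in> parcs G \<and> c w = c v} \<le> ?d)"
    if L: "\<forall>v\<in>pverts G. finite (L v) \<and> card (L v) = 2 * k + 1" for L :: "'a \<Rightarrow> nat set"
  \<comment> \<open>With \<open>m = 2 * k\<close> the lists have \<open>Suc m\<close> colours, and
    \<open>?d + m\<close> is exactly the threshold \<open>l\<close> of
    \<open>thickness_light_edge\<close>.\<close>
  proof (rule light_edge_colouring[where m = "2 * k"])
    fix V' E' assume V': "V' \<subseteq> pverts G" and E': "E' \<subseteq> parcs G"
      and sub: "E' \<subseteq> V' \<times> V'" "sym E'" "V' \<noteq> {}"
    show "(\<exists>v\<in>V'. card (E' `` {v}) \<le> 2 * k) \<or>
      (\<exists>(u, v)\<in>E'. card (E' `` {u}) \<le> ?d + 2 * k \<and> card (E' `` {v}) \<le> ?d + 2 * k)"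
    proof (cases "\<exists>v\<in>V'. card (E' `` {v}) \<le> 2 * k")
      case False
      then have deg: "card (E' `` {v}) \<ge> 2 * k + 1" if "v \<in> V'" for v
        using that by (simp add: not_le Suc_le_eq)
      have "irrefl E'" using pair_graphD(4)[OF G] E' by (auto simp: irrefl_def)
      moreover have "finite V'" using V' pair_graphD(1)[OF G] by (rule finite_subset)
      ultimately show ?thesis
        using thickness_light_edge[OF thick E' _ _ sub(1,2,3) k deg, of "?d + 2 * k"] by simp
    qed simp
  qed (use L pair_graphD[OF G] in auto)
  then show ?thesis unfolding defective_choosable_def has_defect_def by blast
qed

subsection \<open>Coning the faces of a cell decomposition\<close>

text \<open>Orbits are named by the values of a function, so that they can be counted as an image
  and the orbits after coning can be written down explicitly.\<close>

definition orbit_label :: "'f set \<Rightarrow> ('f \<Rightarrow> 'f) \<Rightarrow> ('f \<Rightarrow> 'f) \<Rightarrow> ('f \<Rightarrow> 'b) \<Rightarrow> bool" where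
  "orbit_label F a b l \<longleftrightarrow> (\<forall>x\<in>F. l (a x) = l x \<and> l (b x) = l x) \<and>
     (\<forall>x\<in>F. \<forall>y\<in>F. l x = l y \<longrightarrow> (x, y) \<in> (steps F a \<union> steps F b)\<^sup>*)"

lemma orbit_labelD:
  assumes "orbit_label F a b l"
  shows "x \<in> F \<Longrightarrow> l (a x) = l x" "x \<in> F \<Longrightarrow> l (b x) = l x"
    "x \<in> F \<Longrightarrow> y \<in> F \<Longrightarrow> l x = l y \<Longrightarrow> (x, y) \<in> (steps F a \<union> steps F b)\<^sup>*"
  using assms by (auto simp: orbit_label_def)

lemma class_of_eq_label:
  assumes l: "orbit_label F a b l" and closed: "\<And>x. x \<in> F \<Longrightarrow> a x \<in> F \<and> b x \<in> F" and x: "x \<in> F"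
  shows "class_of (steps F a \<union> steps F b) x = {y \<in> F. l y = l x}"
proof
  show "class_of (steps F a \<union> steps F b) x \<subseteq> {y \<in> F. l y = l x}"
    by (rule class_of_subset) (auto simp: closed x orbit_labelD(1,2)[OF l])
  show "{y \<in> F. l y = l x} \<subseteq> class_of (steps F a \<union> steps F b) x"
    using orbit_labelD(3)[OF l x] by (auto simp: mem_class_of)
qed

lemma card_orbits2_eq_labels:
  assumes l: "orbit_label F a b l" and closed: "\<And>x. x \<in> F \<Longrightarrow> a x \<in> F \<and> b x \<in> F"
  shows "card (orbits2 F a b) = card (l ` F)"
proof -
  have "orbits2 F a b = (\<lambda>c. {y \<in> F. l y = c}) ` l ` F"
    unfolding orbits2_eq_classes image_image
    by (rule image_cong[OF refl]) (rule class_of_eq_label[OF l closed])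
  moreover have "inj_on (\<lambda>c. {y \<in> F. l y = c}) (l ` F)" by (rule inj_onI) auto
  ultimately show ?thesis by (simp add: card_image)
qed

lemma rtrancl_map:
  assumes "\<And>x y. (x, y) \<in> R \<Longrightarrow> (f x, f y) \<in> S\<^sup>*" "(x, y) \<in> R\<^sup>*"
  shows "(f x, f y) \<in> S\<^sup>*"
  using assms(2) by induction (auto intro: rtrancl_trans assms(1))

text \<open>
  Coning every face from its centre cuts each flag \<open>x\<close> into three: \<open>base x\<close> stays at the old edge,
  \<open>side x\<close> and \<open>apex x\<close> lie on the new edge from the vertex of \<open>x\<close> to the centre of its face,
  at the vertex and at the centre. All three belong to the new triangle over the side of \<open>x\<close>.
\<close>

definition base :: "nat \<Rightarrow> nat" where "base x = 3 * x"
definition side :: "nat \<Rightarrow> nat" where "side x = 3 * x + 1"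
definition apex :: "nat \<Rightarrow> nat" where "apex x = 3 * x + 2"

definition cone_flags :: "nat set \<Rightarrow> nat set" where
  "cone_flags F = base ` F \<union> side ` F \<union> apex ` F"

definition cone_map :: "(nat \<Rightarrow> 'b) \<Rightarrow> (nat \<Rightarrow> 'b) \<Rightarrow> (nat \<Rightarrow> 'b) \<Rightarrow> nat \<Rightarrow> 'b" where
  "cone_map f g h n =
    (if n mod 3 = 0 then f (n div 3) else if n mod 3 = 1 then g (n div 3) else h (n div 3))"

lemma cone_map_simps [simp]:
  "cone_map f g h (base x) = f x" "cone_map f g h (side x) = g x" "cone_map f g h (apex x) = h x"
proof -
  have "(3 * x) mod 3 = 0" "(3 * x) div 3 = x" "(3 * x + 1) mod 3 = 1" "(3 * x + 1) div 3 = x"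
    "(3 * x + 2) mod 3 = 2" "(3 * x + 2) div 3 = x" by presburger+
  then show "cone_map f g h (base x) = f x" "cone_map f g h (side x) = g x"
    "cone_map f g h (apex x) = h x"
    by (simp_all only: cone_map_def base_def side_def apex_def) simp_all
qed

lemma cone_flag_simps [simp]:
  "base x = base y \<longleftrightarrow> x = y" "side x = side y \<longleftrightarrow> x = y" "apex x = apex y \<longleftrightarrow> x = y"
  "base x \<noteq> side y" "base x \<noteq> apex y" "side x \<noteq> base y" "side x \<noteq> apex y"
  "apex x \<noteq> base y" "apex x \<noteq> side y"
  unfolding base_def side_def apex_def by presburger+

lemma mem_cone_flags [simp]:
  "base x \<in> cone_flags F \<longleftrightarrow> x \<in> F" "side x \<in> cone_flags F \<longleftrightarrow> x \<in> F"
  "apex x \<in> cone_flags F \<longleftrightarrow> x \<in> F"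
  by (auto simp: cone_flags_def)

lemma cone_flags_cases:
  assumes "n \<in> cone_flags F"
  obtains (base) x where "x \<in> F" "n = base x" | (side) x where "x \<in> F" "n = side x"
    | (apex) x where "x \<in> F" "n = apex x"
  using assms by (auto simp: cone_flags_def)

lemma card_cone_flags:
  assumes "finite F"
  shows "card (cone_flags F) = 3 * card F"
proof -
  have "card (base ` F) = card F" "card (side ` F) = card F" "card (apex ` F) = card F"
    by (simp_all add: card_image inj_on_def)
  moreover have "card (cone_flags F) = card (base ` F) + card (side ` F) + card (apex ` F)"
    unfolding cone_flags_def using assms by (subst card_Un_disjoint; auto)+
  ultimately show ?thesis by simp
qed

section \<open>The coned surface and its orbits\<close>

locale nat_surface = cell_surface F a0 a1 a2 for F :: "nat set" and a0 a1 a2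
begin

text \<open>On \<open>base\<close> flags \<open>b0\<close> and \<open>b2\<close> act as on the old
  edge. On the others, \<open>b0\<close> reverses a new edge and \<open>b2\<close> crosses it by
  \<open>a1\<close> into the neighbouring triangle. \<open>b1\<close> turns between old and new edge
  at an old vertex, and between the two new edges of a triangle at a centre.\<close>

abbreviation "b0 \<equiv> cone_map (\<lambda>x. base (a0 x)) apex side"
abbreviation "b1 \<equiv> cone_map side base (\<lambda>x. apex (a0 x))"
abbreviation "b2 \<equiv> cone_map (\<lambda>x. base (a2 x)) (\<lambda>x. side (a1 x)) (\<lambda>x. apex (a1 x))"

lemma cone_surface: "cell_surface (cone_flags F) b0 b1 b2"
proof
  show "finite (cone_flags F)" using finite_flags by (simp add: cone_flags_def)
  show "cone_flags F \<noteq> {}" using flags_nonempty by (simp add: cone_flags_def)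
  fix n assume n: "n \<in> cone_flags F"
  then show "b0 n \<in> cone_flags F \<and> b1 n \<in> cone_flags F \<and> b2 n \<in> cone_flags F"
    by (cases rule: cone_flags_cases) (simp_all add: flagD)
  show "b0 (b0 n) = n \<and> b1 (b1 n) = n \<and> b2 (b2 n) = n"
    using n by (cases rule: cone_flags_cases) (simp_all add: flagD)
  show "b0 n \<noteq> n \<and> b1 n \<noteq> n \<and> b2 n \<noteq> n"
    using n by (cases rule: cone_flags_cases) (simp_all add: flagD)
  show "b0 (b2 n) = b2 (b0 n)"
    using n by (cases rule: cone_flags_cases) (simp_all add: flagD)
  show "b0 (b2 n) \<noteq> n"
    using n by (cases rule: cone_flags_cases) (simp_all add: flagD)
next
  fix n m assume n: "n \<in> cone_flags F" and m: "m \<in> cone_flags F"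
  let ?R = "{(z, b0 z) | z. z \<in> cone_flags F} \<union> {(z, b1 z) | z. z \<in> cone_flags F} \<union>
    {(z, b2 z) | z. z \<in> cone_flags F}"
  have R_step: "(k, b0 k) \<in> ?R\<^sup>*" "(k, b1 k) \<in> ?R\<^sup>*" "(k, b2 k) \<in> ?R\<^sup>*" if "k \<in> cone_flags F" for k
    using that by (blast intro: r_into_rtrancl)+
  have to_side: "(base x, side x) \<in> ?R\<^sup>*" "(side x, base x) \<in> ?R\<^sup>*" if "x \<in> F" for x
    using R_step(2)[of "base x"] R_step(2)[of "side x"] that by simp_all
  have to_apex: "(side x, apex x) \<in> ?R\<^sup>*" "(apex x, side x) \<in> ?R\<^sup>*" if "x \<in> F" for x
    using R_step(1)[of "side x"] R_step(1)[of "apex x"] that by simp_all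
  have n': "\<exists>x\<in>F. (n, base x) \<in> ?R\<^sup>*"
    using n by (cases rule: cone_flags_cases) (blast intro: to_side to_apex rtrancl_trans)+
  have m': "\<exists>x\<in>F. (base x, m) \<in> ?R\<^sup>*"
    using m by (cases rule: cone_flags_cases) (blast intro: to_side to_apex rtrancl_trans)+
  have "(base x, base y) \<in> ?R\<^sup>*" if "x \<in> F" "y \<in> F" for x y
  proof (rule rtrancl_map[OF _ connected[OF that]])
    fix x y assume "(x, y) \<in> {(z, a0 z) | z. z \<in> F} \<union> {(z, a1 z) | z. z \<in> F} \<union> {(z, a2 z) | z. z \<in> F}"
    then have x: "x \<in> F" and "y = a0 x \<or> y = a1 x \<or> y = a2 x" by auto
    moreover have "(base x, base (a0 x)) \<in> ?R\<^sup>*" "(base x, base (a2 x)) \<in> ?R\<^sup>*"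
      using R_step(1)[of "base x"] R_step(3)[of "base x"] x by simp_all
    moreover have "(side x, side (a1 x)) \<in> ?R\<^sup>*" using R_step(3)[of "side x"] x by simp
    then have "(base x, base (a1 x)) \<in> ?R\<^sup>*"
      using to_side(1)[OF x] to_side(2)[OF flagD(2)[OF x]] by (meson rtrancl_trans)
    ultimately show "(base x, base y) \<in> ?R\<^sup>*" by blast
  qed
  then show "(n, m) \<in> ?R\<^sup>*" using n' m' by (meson rtrancl_trans)
qed

text \<open>Even labels are old vertices and odd labels are face centres, which inherit the labels
  of their faces.\<close>

lemma cone_vertex_label:
  fixes l p :: "nat \<Rightarrow> nat"
  assumes l: "orbit_label F a1 a2 l" and p: "orbit_label F a0 a1 p"
  defines "l' \<equiv> cone_map (\<lambda>x. 2 * l x) (\<lambda>x. 2 * l x) (\<lambda>x. 2 * p x + 1)"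
  shows "orbit_label (cone_flags F) b1 b2 l'"
    and "card (l' ` cone_flags F) = card (l ` F) + card (p ` F)"
proof -
  have parity: "2 * i \<noteq> 2 * j + 1" for i j :: nat by presburger
  let ?R = "steps (cone_flags F) b1 \<union> steps (cone_flags F) b2"
  have R_step: "(k, b1 k) \<in> ?R\<^sup>*" "(k, b2 k) \<in> ?R\<^sup>*" if "k \<in> cone_flags F" for k
    using that by (auto intro: r_into_rtrancl)
  have to_side: "(base x, side x) \<in> ?R\<^sup>*" "(side x, base x) \<in> ?R\<^sup>*" if "x \<in> F" for x
    using R_step(1)[of "base x"] R_step(1)[of "side x"] that by simp_all
  have base: "(base x, base y) \<in> ?R\<^sup>*" if "x \<in> F" "y \<in> F" "l x = l y" for x y
  proof (rule rtrancl_map[OF _ orbit_labelD(3)[OF l that]])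
    fix x y assume "(x, y) \<in> steps F a1 \<union> steps F a2"
    then have x: "x \<in> F" and "y = a1 x \<or> y = a2 x" by auto
    moreover have "(base x, base (a2 x)) \<in> ?R\<^sup>*" using R_step(2)[of "base x"] x by simp
    moreover have "(side x, side (a1 x)) \<in> ?R\<^sup>*" using R_step(2)[of "side x"] x by simp
    then have "(base x, base (a1 x)) \<in> ?R\<^sup>*"
      using to_side(1)[OF x] to_side(2)[OF flagD(2)[OF x]] by (meson rtrancl_trans)
    ultimately show "(base x, base y) \<in> ?R\<^sup>*" by blast
  qed
  have apex: "(apex x, apex y) \<in> ?R\<^sup>*" if "x \<in> F" "y \<in> F" "p x = p y" for x y
  proof (rule rtrancl_map[OF _ orbit_labelD(3)[OF p that]])
    fix x y assume "(x, y) \<in> steps F a0 \<union> steps F a1"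
    then have x: "x \<in> F" and "y = a0 x \<or> y = a1 x" by auto
    moreover have "(apex x, apex (a0 x)) \<in> ?R\<^sup>*" "(apex x, apex (a1 x)) \<in> ?R\<^sup>*"
      using R_step[of "apex x"] x by simp_all
    ultimately show "(apex x, apex y) \<in> ?R\<^sup>*" by blast
  qed
  have to_base: "\<exists>x\<in>F. l' n = 2 * l x \<and> (n, base x) \<in> ?R\<^sup>* \<and> (base x, n) \<in> ?R\<^sup>*"
    if n: "n \<in> cone_flags F" "even (l' n)" for n
    using n(1) by (cases rule: cone_flags_cases) (use n(2) to_side in \<open>auto simp: l'_def\<close>)
  have is_apex: "\<exists>x\<in>F. l' n = 2 * p x + 1 \<and> n = apex x" if n: "n \<in> cone_flags F" "odd (l' n)" for n
    using n(1) by (cases rule: cone_flags_cases) (use n(2) in \<open>auto simp: l'_def\<close>)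
  show "orbit_label (cone_flags F) b1 b2 l'"
    unfolding orbit_label_def
  proof (intro conjI ballI impI)
    fix n assume "n \<in> cone_flags F"
    then show "l' (b1 n) = l' n" "l' (b2 n) = l' n"
      by (cases rule: cone_flags_cases; simp add: l'_def orbit_labelD[OF l] orbit_labelD[OF p])+
  next
    fix n m assume n: "n \<in> cone_flags F" and m: "m \<in> cone_flags F" and eq: "l' n = l' m"
    show "(n, m) \<in> ?R\<^sup>*"
    proof (cases "even (l' n)")
      case True
      obtain x y where "x \<in> F" "l' n = 2 * l x" "(n, base x) \<in> ?R\<^sup>*"
        "y \<in> F" "l' m = 2 * l y" "(base y, m) \<in> ?R\<^sup>*"
        using to_base[OF n] to_base[OF m] True eq by metis
      then show ?thesis using base[of x y] eq by simp
    next
      case False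
      obtain x y where "x \<in> F" "l' n = 2 * p x + 1" "n = apex x"
        "y \<in> F" "l' m = 2 * p y + 1" "m = apex y"
        using is_apex[OF n] is_apex[OF m] False eq by metis
      then show ?thesis using apex[of x y] eq by simp
    qed
  qed
  have "l' ` cone_flags F = (\<lambda>i. 2 * i) ` l ` F \<union> (\<lambda>i. 2 * i + 1) ` p ` F"
    by (simp add: cone_flags_def image_Un image_image l'_def)
  moreover have "(\<lambda>i. 2 * i) ` l ` F \<inter> (\<lambda>i. 2 * i + 1) ` p ` F = {}" using parity by blast
  ultimately show "card (l' ` cone_flags F) = card (l ` F) + card (p ` F)"
    using finite_flags by (simp add: card_Un_disjoint card_image inj_on_def)
qed

text \<open>Each new triangle stands over one side \<open>{x, a0 x}\<close> of an old face, and
  \<open>min\<close> picks a canonical flag of this side.\<close>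

lemma cone_face_label:
  defines "p' \<equiv> cone_map (\<lambda>x. min x (a0 x)) (\<lambda>x. min x (a0 x)) (\<lambda>x. min x (a0 x))"
  shows "orbit_label (cone_flags F) b0 b1 p'" and "2 * card (p' ` cone_flags F) = card F"
proof -
  have same: "min y (a0 y) = min x (a0 x) \<longleftrightarrow> y = x \<or> y = a0 x" if "x \<in> F" "y \<in> F" for x y
    using flagD(4)[OF that(1)] flagD(4)[OF that(2)] by (metis min.commute min_def)
  let ?R = "steps (cone_flags F) b0 \<union> steps (cone_flags F) b1"
  have R_step: "(k, b0 k) \<in> ?R\<^sup>*" "(k, b1 k) \<in> ?R\<^sup>*" if "k \<in> cone_flags F" for k
    using that by (auto intro: r_into_rtrancl)
  have to_side: "(base x, side x) \<in> ?R\<^sup>*" "(side x, base x) \<in> ?R\<^sup>*" if "x \<in> F" for x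
    using R_step(2)[of "base x"] R_step(2)[of "side x"] that by simp_all
  have to_apex: "(side x, apex x) \<in> ?R\<^sup>*" "(apex x, side x) \<in> ?R\<^sup>*" if "x \<in> F" for x
    using R_step(1)[of "side x"] R_step(1)[of "apex x"] that by simp_all
  have to_base: "\<exists>x\<in>F. p' n = min x (a0 x) \<and> (n, base x) \<in> ?R\<^sup>* \<and> (base x, n) \<in> ?R\<^sup>*"
    if "n \<in> cone_flags F" for n
    using that
  proof (cases rule: cone_flags_cases)
    case (apex x)
    then have "(n, base x) \<in> ?R\<^sup>*" "(base x, n) \<in> ?R\<^sup>*"
      using to_side to_apex by (meson rtrancl_trans)+
    then show ?thesis using apex by (auto simp: p'_def)
  qed (use to_side in \<open>auto simp: p'_def\<close>)
  show "orbit_label (cone_flags F) b0 b1 p'"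
    unfolding orbit_label_def
  proof (intro conjI ballI impI)
    fix n assume "n \<in> cone_flags F"
    then show "p' (b0 n) = p' n" "p' (b1 n) = p' n"
      by (cases rule: cone_flags_cases; simp add: p'_def flagD min.commute)+
  next
    fix n m assume n: "n \<in> cone_flags F" and m: "m \<in> cone_flags F" and eq: "p' n = p' m"
    obtain x y where xy: "x \<in> F" "p' n = min x (a0 x)" "(n, base x) \<in> ?R\<^sup>*"
      "y \<in> F" "p' m = min y (a0 y)" "(base y, m) \<in> ?R\<^sup>*"
      using to_base[OF n] to_base[OF m] by metis
    then have "y = x \<or> y = a0 x" using same[of x y] eq by simp
    moreover have "(base x, base (a0 x)) \<in> ?R\<^sup>*" using R_step(1)[of "base x"] xy(1) by simp
    ultimately have "(base x, base y) \<in> ?R\<^sup>*" by auto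
    then show "(n, m) \<in> ?R\<^sup>*" using xy by (meson rtrancl_trans)
  qed
  have "card {y \<in> F. min y (a0 y) = min x (a0 x)} = 2" if x: "x \<in> F" for x
  proof -
    have "{y \<in> F. min y (a0 y) = min x (a0 x)} = {x, a0 x}"
    proof (rule set_eqI)
      fix y
      have "y \<in> F" if "y = x \<or> y = a0 x" using that x flagD(1)[OF x] by blast
      then show "y \<in> {y \<in> F. min y (a0 y) = min x (a0 x)} \<longleftrightarrow> y \<in> {x, a0 x}"
        using same[OF x, of y] by blast
    qed
    then show ?thesis using flagD(7)[OF x] by simp
  qed
  then have "card F = 2 * card ((\<lambda>x. min x (a0 x)) ` F)"
    by (rule card_eq_mult_fibres[OF finite_flags])
  moreover have "p' ` cone_flags F = (\<lambda>x. min x (a0 x)) ` F"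
    by (simp add: cone_flags_def image_Un image_image p'_def)
  ultimately show "2 * card (p' ` cone_flags F) = card F" by simp
qed

end

subsection \<open>Drawings on the sphere\<close>

text \<open>The equation says that vertices minus edges plus faces equal 2, multiplied by four, with
  a quarter of the flags as the number of edges.\<close>

definition sphere_drawing :: "'a set \<Rightarrow> ('a \<times> 'a) set \<Rightarrow> bool" where
  "sphere_drawing V E \<longleftrightarrow> (\<exists>F a0 a1 a2 (l :: nat \<Rightarrow> nat) (p :: nat \<Rightarrow> nat) (h :: 'a \<Rightarrow> nat).
     cell_surface F a0 a1 a2 \<and> orbit_label F a1 a2 l \<and> orbit_label F a0 a1 p \<and>
     4 * (card (l ` F) + card (p ` F)) = card F + 8 \<and> inj_on h V \<and> h ` V \<subseteq> l ` F \<and>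
     (\<forall>(u, v)\<in>E. \<exists>x\<in>F. l x = h u \<and> l (a0 x) = h v))"

text \<open>A drawing may be larger than the graph and have another vertex type; \<open>e\<close>
  locates the graph inside it.\<close>

lemma sphere_drawing_genus:
  assumes draw: "sphere_drawing V E" and e: "inj_on e (pverts H)" "e ` pverts H \<subseteq> V"
    and arcs: "\<And>u v. (u, v) \<in> parcs H \<Longrightarrow> (e u, e v) \<in> E"
    and HV: "parcs H \<subseteq> pverts H \<times> pverts H"
  shows "euler_genus H \<le> enat g"
proof -
  obtain F a0 a1 a2 and l p :: "nat \<Rightarrow> nat" and h :: "'a \<Rightarrow> nat" where cs: "cell_surface F a0 a1 a2"
    and l: "orbit_label F a1 a2 l" and p: "orbit_label F a0 a1 p"
    and eq: "4 * (card (l ` F) + card (p ` F)) = card F + 8"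
    and h: "inj_on h V" "h ` V \<subseteq> l ` F"
    and E: "\<forall>(u, v)\<in>E. \<exists>x\<in>F. l x = h u \<and> l (a0 x) = h v"
    using draw unfolding sphere_drawing_def by (elim exE conjE) (rule that)
  interpret cell_surface F a0 a1 a2 by (rule cs)
  have "card (surface_vertices F a0 a1 a2) = card (l ` F)"
    unfolding surface_vertices_def using l by (rule card_orbits2_eq_labels) (simp add: flagD)
  moreover have "card (surface_faces F a0 a1 a2) = card (p ` F)"
    unfolding surface_faces_def using p by (rule card_orbits2_eq_labels) (simp add: flagD)
  moreover have "card F = 4 * card (surface_edges F a0 a1 a2)"
    using card_closed_eq_edges[of F] flagD by (simp add: surface_edges_eq edge_closed_def)
  ultimately have genus: "surface_euler_genus F a0 a1 a2 = int 0"
    using eq by (simp add: surface_euler_genus_def euler_characteristic_def)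
  define f where "f u = {x \<in> F. l x = h (e u)}" for u
  have f_ne: "\<exists>x. x \<in> F \<and> l x = h (e u)" if "u \<in> pverts H" for u
  proof -
    have "h (e u) \<in> l ` F" using that e(2) h(2) by blast
    then show ?thesis by auto
  qed
  have "inj_on f (pverts H)"
  proof (rule inj_onI)
    fix u v assume uv: "u \<in> pverts H" "v \<in> pverts H" "f u = f v"
    obtain x where "x \<in> F" "l x = h (e u)" using f_ne[OF uv(1)] by blast
    then have "x \<in> f v" using uv(3) by (auto simp: f_def)
    then have "h (e u) = h (e v)" using \<open>l x = h (e u)\<close> by (simp add: f_def)
    then have "e u = e v" using inj_onD[OF h(1)] e(2) uv by blast
    then show "u = v" using inj_onD[OF e(1)] uv by blast
  qed
  moreover have "f u \<in> surface_vertices F a0 a1 a2" if u: "u \<in> pverts H" for u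
  proof -
    obtain x where x: "x \<in> F" "l x = h (e u)" using f_ne[OF u] by blast
    have "vertex_of x = f u"
      unfolding vertex_of_def f_def using class_of_eq_label[OF l _ x(1)] x(2) flagD by simp
    then show ?thesis using x(1) unfolding surface_vertices_eq by blast
  qed
  moreover have "\<exists>x\<in>f u. a0 x \<in> f v" if uv: "(u, v) \<in> parcs H" for u v
  proof -
    obtain x where "x \<in> F" "l x = h (e u)" "l (a0 x) = h (e v)" using arcs[OF uv] E by blast
    then show ?thesis using flagD(1) by (auto simp: f_def)
  qed
  ultimately have emb: "embeds_in_surface H F a0 a1 a2"
    unfolding embeds_in_surface_def by (intro exI[of _ f]) auto
  have "euler_genus H \<le> enat 0"
    unfolding euler_genus_def
    by (rule Inf_lower, rule CollectI, rule exI[of _ 0], rule conjI[OF refl])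
      (intro exI conjI; (rule cs | rule genus | rule emb))
  also have "\<dots> \<le> enat g" by simp
  finally show ?thesis .
qed

text \<open>A single edge on the sphere: four flags, two vertices, one face. Both ends have degree
  one, which is why \<open>a1\<close> and \<open>a2\<close> coincide.\<close>

lemma sphere_drawing_edge:
  assumes "u \<noteq> v"
  shows "sphere_drawing {u, v} {(u, v), (v, u)}"
proof -
  define F :: "nat set" where "F = {0, 1, 2, 3}"
  define a b :: "nat \<Rightarrow> nat" where "a = (\<lambda>_. 0)(0 := 1, 1 := 0, 2 := 3, 3 := 2)"
    and "b = (\<lambda>_. 0)(0 := 2, 2 := 0, 1 := 3, 3 := 1)"
  define l :: "nat \<Rightarrow> nat" where "l = (\<lambda>_. 0)(1 := 1, 3 := 1)"
  have ab: "a 0 = 1" "a 1 = 0" "a 2 = 3" "a 3 = 2" "b 0 = 2" "b 1 = 3" "b 2 = 0" "b 3 = 1"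
    and l: "l 0 = 0" "l 1 = 1" "l 2 = 0" "l 3 = 1"
    by (simp_all add: a_def b_def l_def)
  have F: "x = 0 \<or> x = 1 \<or> x = 2 \<or> x = 3" if "x \<in> F" for x using that by (simp add: F_def)
  have R: "(x, y) \<in> R\<^sup>*" if "x \<in> F" "y \<in> F" and R: "R = steps F a \<union> steps F b" for x y and R
  proof -
    have "(0, 1) \<in> R" "(1, 0) \<in> R" "(2, 3) \<in> R" "(3, 2) \<in> R" "(0, 2) \<in> R" "(2, 0) \<in> R"
      by (simp_all add: R ab F_def del: One_nat_def)
    then have "(x, 0) \<in> R\<^sup>* \<and> (0, x) \<in> R\<^sup>*" if "x \<in> F" for x
      using F[OF that] by (meson r_into_rtrancl rtrancl.rtrancl_refl rtrancl_trans)
    then show ?thesis using that by (meson rtrancl_trans)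
  qed
  have 1: "cell_surface F a b b"
  proof
    fix x assume "x \<in> F"
    note x = F[OF this]
    show "a x \<in> F \<and> b x \<in> F \<and> b x \<in> F" using x by (elim disjE; simp add: ab F_def del: One_nat_def)
    show "a (a x) = x \<and> b (b x) = x \<and> b (b x) = x" "a x \<noteq> x \<and> b x \<noteq> x \<and> b x \<noteq> x"
      "a (b x) = b (a x)" "a (b x) \<noteq> x"
      using x by (elim disjE; simp add: ab del: One_nat_def)+
  next
    fix x y assume "x \<in> F" "y \<in> F"
    then show "(x, y) \<in> ({(z, a z) | z. z \<in> F} \<union> {(z, b z) | z. z \<in> F} \<union> {(z, b z) | z. z \<in> F})\<^sup>*"
      using R[of x y "steps F a \<union> steps F b"] by (simp add: steps_def Un_assoc)
  qed (simp_all add: F_def)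
  have 2: "orbit_label F b b l"
    unfolding orbit_label_def
  proof (intro conjI ballI impI)
    fix x assume "x \<in> F"
    note x = F[OF this]
    show "l (b x) = l x" "l (b x) = l x"
      using x by (elim disjE; simp add: ab l del: One_nat_def)+
  next
    fix x y assume "x \<in> F" "y \<in> F" and eq: "l x = l y"
    have "y = x \<or> y = b x" using F[OF \<open>x \<in> F\<close>] F[OF \<open>y \<in> F\<close>] eq
      by (elim disjE; simp add: ab l del: One_nat_def)
    then show "(x, y) \<in> (steps F b \<union> steps F b)\<^sup>*" using \<open>x \<in> F\<close> by auto
  qed
  have 3: "orbit_label F a b (\<lambda>_. 0 :: nat)"
    using R by (auto simp: orbit_label_def)
  have 4: "4 * (card (l ` F) + card ((\<lambda>_. 0 :: nat) ` F)) = card F + 8"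
    by (simp add: F_def l card_insert_if del: One_nat_def)
  have 5: "inj_on (\<lambda>x. if x = u then 0 else 1 :: nat) {u, v}" using assms by auto
  have 6: "(\<lambda>x. if x = u then 0 else 1 :: nat) ` {u, v} \<subseteq> l ` F"
    by (auto simp: F_def l simp del: One_nat_def)
  have 7: "\<forall>(s, t)\<in>{(u, v), (v, u)}. \<exists>x\<in>F. l x = (if s = u then 0 else 1) \<and>
      l (a x) = (if t = u then 0 else 1)"
    using assms by (auto simp: F_def ab l simp del: One_nat_def)
  show ?thesis
    unfolding sphere_drawing_def
    by (intro exI conjI, rule 1, rule 2, rule 3, rule 4, rule 5, rule 6, rule 7)
qed

text \<open>The new vertex is the centre of a face incident with the edge \<open>uv\<close>, namely
  the face of the flag \<open>x\<close>; \<open>apex x\<close> and \<open>apex (a0 x)\<close> lie on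
  the edges from this centre to the two ends.\<close>

lemma sphere_drawing_insert:
  assumes draw: "sphere_drawing V E" and uv: "(u, v) \<in> E" and w: "w \<notin> V" and EV: "E \<subseteq> V \<times> V"
  shows "sphere_drawing (insert w V) (E \<union> {(w, u), (u, w), (w, v), (v, w)})"
proof -
  obtain F a0 a1 a2 and l p :: "nat \<Rightarrow> nat" and h :: "'a \<Rightarrow> nat" where cs: "cell_surface F a0 a1 a2"
    and l: "orbit_label F a1 a2 l" and p: "orbit_label F a0 a1 p"
    and eq: "4 * (card (l ` F) + card (p ` F)) = card F + 8"
    and h: "inj_on h V" "h ` V \<subseteq> l ` F"
    and E: "\<forall>(u, v)\<in>E. \<exists>x\<in>F. l x = h u \<and> l (a0 x) = h v"
    using draw unfolding sphere_drawing_def by (elim exE conjE) (rule that)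
  interpret nat_surface F a0 a1 a2 unfolding nat_surface_def by (rule cs)
  define l' where "l' = cone_map (\<lambda>x. 2 * l x) (\<lambda>x. 2 * l x) (\<lambda>x. 2 * p x + 1)"
  define p' where "p' = cone_map (\<lambda>x. min x (a0 x)) (\<lambda>x. min x (a0 x)) (\<lambda>x. min x (a0 x))"
  obtain x where x: "x \<in> F" "l x = h u" "l (a0 x) = h v" using E uv by blast
  define h' where "h' t = (if t = w then 2 * p x + 1 else 2 * h t)" for t
  have parity: "2 * i \<noteq> 2 * j + 1" "2 * j + 1 \<noteq> 2 * i" for i j :: nat by presburger+
  have ne: "u \<noteq> w" "v \<noteq> w" using uv EV w by auto
  have 1: "cell_surface (cone_flags F) b0 b1 b2" by (rule cone_surface)
  have 2: "orbit_label (cone_flags F) b1 b2 l'"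
    unfolding l'_def by (rule cone_vertex_label(1)[OF l p])
  have 3: "orbit_label (cone_flags F) b0 b1 p'" unfolding p'_def by (rule cone_face_label(1))
  have "card (l' ` cone_flags F) = card (l ` F) + card (p ` F)"
    unfolding l'_def by (rule cone_vertex_label(2)[OF l p])
  moreover have "2 * card (p' ` cone_flags F) = card F"
    unfolding p'_def by (rule cone_face_label(2))
  \<comment> \<open>Coning adds half as many faces as there were flags and turns the old faces into
    vertices, so the left side grows by twice \<open>card F\<close>, and so does the flag
    count.\<close>
  ultimately have 4: "4 * (card (l' ` cone_flags F) + card (p' ` cone_flags F)) = card (cone_flags F) + 8"
    using eq card_cone_flags[OF finite_flags] by simp
  have 5: "inj_on h' (insert w V)"
    using inj_onD[OF h(1)] parity by (auto simp: inj_on_def h'_def)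
  have 6: "h' ` insert w V \<subseteq> l' ` cone_flags F"
  proof
    fix c assume "c \<in> h' ` insert w V"
    then consider "c = 2 * p x + 1" | t where "t \<in> V" "c = 2 * h t"
      using w by (auto simp: h'_def split: if_splits)
    then show "c \<in> l' ` cone_flags F"
    proof cases
      case 1
      then show ?thesis using x(1) by (intro image_eqI[of _ _ "apex x"]) (simp_all add: l'_def)
    next
      case 2
      then obtain y where "y \<in> F" "h t = l y" using h(2) by blast
      then show ?thesis using 2 by (intro image_eqI[of _ _ "base y"]) (simp_all add: l'_def)
    qed
  qed
  have 7: "\<exists>y\<in>cone_flags F. l' y = h' s \<and> l' (b0 y) = h' t"
    if st: "(s, t) \<in> E \<union> {(w, u), (u, w), (w, v), (v, w)}" for s t
  proof -
    consider "(s, t) \<in> E" | "(s, t) = (w, u)" | "(s, t) = (u, w)" | "(s, t) = (w, v)" | "(s, t) = (v, w)"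
      using st by blast
    then show ?thesis
    proof cases
      case 1
      then obtain y where "y \<in> F" "l y = h s" "l (a0 y) = h t" using E by blast
      moreover have "s \<noteq> w" "t \<noteq> w" using 1 EV w by auto
      ultimately show ?thesis by (intro bexI[of _ "base y"]) (simp_all add: l'_def h'_def)
    next
      case 2
      then show ?thesis using x ne by (intro bexI[of _ "apex x"]) (simp_all add: l'_def h'_def)
    next
      case 3
      then show ?thesis using x ne by (intro bexI[of _ "side x"]) (simp_all add: l'_def h'_def)
    next
      case 4
      then show ?thesis using x ne flagD(1)[OF x(1)] orbit_labelD(1)[OF p x(1)]
        by (intro bexI[of _ "apex (a0 x)"]) (simp_all add: l'_def h'_def)
    next
      case 5
      then show ?thesis using x ne flagD(1)[OF x(1)] orbit_labelD(1)[OF p x(1)]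
        by (intro bexI[of _ "side (a0 x)"]) (simp_all add: l'_def h'_def)
    qed
  qed
  show ?thesis
    unfolding sphere_drawing_def
    by (intro exI conjI, rule 1, rule 2, rule 3, rule 4, rule 5, rule 6) (use 7 in blast)
qed

text \<open>Old edges survive each insertion, so one edge can serve any number of new vertices.
  Planarity is thereby reduced to finding an order of attachment.\<close>

lemma sphere_drawing_attach:
  assumes "finite W" "sphere_drawing V E" "E \<subseteq> V \<times> V" "W \<inter> V = {}"
    and "\<And>w. w \<in> W \<Longrightarrow> (s w, t w) \<in> E"
  shows "sphere_drawing (W \<union> V) (E \<union> (\<Union>w\<in>W. {(w, s w), (s w, w), (w, t w), (t w, w)}))"
  using assms(1,4,5)
proof (induction W rule: finite_induct)
  case empty
  then show ?case using assms(2) by simp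
next
  case (insert w W)
  let ?E = "E \<union> (\<Union>w\<in>W. {(w, s w), (s w, w), (w, t w), (t w, w)})"
  have "sphere_drawing (W \<union> V) ?E" using insert by auto
  moreover have "(s w, t w) \<in> ?E" using insert.prems(2) by auto
  moreover have "w \<notin> W \<union> V" using insert by auto
  moreover have "?E \<subseteq> (W \<union> V) \<times> (W \<union> V)" using assms(3) insert.prems(2) by blast
  ultimately have "sphere_drawing (insert w (W \<union> V))
    (?E \<union> {(w, s w), (s w, w), (w, t w), (t w, w)})" by (rule sphere_drawing_insert)
  then show ?case by (simp add: Un_ac)
qed

subsection \<open>Closures of complete trees\<close>

definition tree_nodes :: "nat \<Rightarrow> nat \<Rightarrow> nat list set" where
  "tree_nodes h N = {xs. length xs \<le> h \<and> set xs \<subseteq> {..<N}}"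

text \<open>
  A node of the complete \<open>N\<close>-ary tree of height \<open>h\<close> is the path leading to it from the root.
  Every node is adjacent to its proper ancestors whose depth lies in \<open>J\<close>.
\<close>

definition tree_arcs :: "nat \<Rightarrow> nat \<Rightarrow> nat set \<Rightarrow> (nat list \<times> nat list) set" where
  "tree_arcs h N J = {(xs, ys). xs \<in> tree_nodes h N \<and> ys \<in> tree_nodes h N \<and>
     (\<exists>j\<in>J. j < length xs \<and> ys = take j xs \<or> j < length ys \<and> xs = take j ys)}"

text \<open>Nodes are coded by natural numbers because the lower bound concerns graphs on
  \<open>nat\<close>.\<close>

definition tree_closure :: "nat \<Rightarrow> nat \<Rightarrow> nat set \<Rightarrow> nat pair_pre_digraph" where
  "tree_closure h N J = \<lparr>pverts = {u. list_decode u \<in> tree_nodes h N},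
     parcs = {(u, v). (list_decode u, list_decode v) \<in> tree_arcs h N J}\<rparr>"

lemma tree_closure_simps [simp]:
  "pverts (tree_closure h N J) = {u. list_decode u \<in> tree_nodes h N}"
  "parcs (tree_closure h N J) = {(u, v). (list_decode u, list_decode v) \<in> tree_arcs h N J}"
  by (simp_all add: tree_closure_def)

lemma finite_tree_nodes: "finite (tree_nodes h N)"
  using finite_lists_length_le[of "{..<N}" h] by (simp add: tree_nodes_def conj_commute)

lemma take_tree_nodes: "xs \<in> tree_nodes h N \<Longrightarrow> take j xs \<in> tree_nodes h N"
  using set_take_subset[of j xs] by (auto simp: tree_nodes_def)

lemma tree_arcs_irrefl: "(xs, xs) \<notin> tree_arcs h N J"
proof -
  have "xs \<noteq> take j xs" if "j < length xs" for j
  proof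
    assume "xs = take j xs"
    then have "length xs = length (take j xs)" by (rule arg_cong)
    then show False using that by simp
  qed
  then show ?thesis by (simp add: tree_arcs_def)
qed

lemma tree_arcs_UN: "tree_arcs h N (\<Union>i\<in>I. J i) = (\<Union>i\<in>I. tree_arcs h N (J i))"
  unfolding tree_arcs_def by blast

lemma pair_graph_tree_closure: "pair_graph (tree_closure h N J)"
proof -
  let ?G = "tree_closure h N J"
  have V: "pverts ?G = list_encode ` tree_nodes h N"
    by (auto simp: image_iff) (metis list_decode_inverse)
  have fin: "finite (pverts ?G)" unfolding V using finite_tree_nodes by (rule finite_imageI)
  have sub: "parcs ?G \<subseteq> pverts ?G \<times> pverts ?G" by (auto simp: tree_arcs_def)
  show ?thesis
  proof
    show "finite (pverts ?G)" by (rule fin)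
    show "finite (parcs ?G)" using finite_subset[OF sub] fin by blast
    show "symmetric (with_proj ?G)"
      by (auto simp: symmetric_def arcs_ends_def arc_to_ends_def sym_def tree_arcs_def)
  next
    fix e assume e: "e \<in> parcs ?G"
    then show "fst e \<in> pverts ?G" "snd e \<in> pverts ?G" using sub by auto
    show "fst e \<noteq> snd e" using e tree_arcs_irrefl by (cases e) auto
  qed
qed

text \<open>A node deeper than \<open>Suc j\<close> attaches to the tree edge between its ancestors
  at depths \<open>j\<close> and \<open>Suc j\<close>. An auxiliary edge outside the tree starts the
  construction: nodes of depth at most \<open>j\<close> attach to both of its ends, those of depth
  \<open>Suc j\<close> to their parent and one end.\<close>

lemma sphere_drawing_tree_closure:
  "\<exists>V E. sphere_drawing V E \<and> tree_nodes h N \<subseteq> V \<and> tree_arcs h N {j, Suc j} \<subseteq> E"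
proof -
  let ?T = "tree_nodes h N"
  \<comment> \<open>Entries of nodes are less than \<open>N\<close>, so these two lists are not
    nodes.\<close>
  let ?y = "[N]" and ?z = "[Suc N]"
  define P where "P = {xs \<in> ?T. length xs \<le> j}"
  define Q where "Q = {xs \<in> ?T. length xs = Suc j}"
  define R where "R = {xs \<in> ?T. length xs > Suc j}"
  have fin: "finite P" "finite Q" "finite R"
    using finite_tree_nodes by (auto simp: P_def Q_def R_def)
  have yz: "?y \<notin> ?T" "?z \<notin> ?T" by (auto simp: tree_nodes_def)
  let ?E0 = "{(?y, ?z), (?z, ?y)}"
  let ?V1 = "P \<union> {?y, ?z}"
  let ?E1 = "?E0 \<union> (\<Union>w\<in>P. {(w, ?y), (?y, w), (w, ?z), (?z, w)})"
  have 1: "sphere_drawing ?V1 ?E1"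
    by (rule sphere_drawing_attach[OF fin(1) sphere_drawing_edge]) (use yz in \<open>auto simp: P_def\<close>)
  have sub1: "?E1 \<subseteq> ?V1 \<times> ?V1" by blast
  have PQ: "take j w \<in> P" if "w \<in> Q" for w
    using that take_tree_nodes[of w h N j] by (auto simp: P_def Q_def)
  let ?V2 = "Q \<union> ?V1"
  let ?E2 = "?E1 \<union> (\<Union>w\<in>Q. {(w, take j w), (take j w, w), (w, ?y), (?y, w)})"
  have 2: "sphere_drawing ?V2 ?E2"
  proof (rule sphere_drawing_attach[OF fin(2) 1 sub1])
    show "Q \<inter> ?V1 = {}" using yz by (auto simp: P_def Q_def)
    show "(take j w, ?y) \<in> ?E1" if "w \<in> Q" for w using PQ[OF that] by blast
  qed
  have sub2: "?E2 \<subseteq> ?V2 \<times> ?V2" using sub1 PQ by blast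
  have QR: "take (Suc j) w \<in> Q" "take j (take (Suc j) w) = take j w" if "w \<in> R" for w
    using that take_tree_nodes[of w h N "Suc j"] by (auto simp: Q_def R_def min_def)
  let ?V3 = "R \<union> ?V2"
  let ?E3 = "?E2 \<union> (\<Union>w\<in>R. {(w, take j w), (take j w, w),
    (w, take (Suc j) w), (take (Suc j) w, w)})"
  have 3: "sphere_drawing ?V3 ?E3"
  proof (rule sphere_drawing_attach[OF fin(3) 2 sub2])
    show "R \<inter> ?V2 = {}" using yz by (auto simp: P_def Q_def R_def)
    fix w assume w: "w \<in> R"
    have "(take j (take (Suc j) w), take (Suc j) w) \<in> ?E2" using QR(1)[OF w] by blast
    then show "(take j w, take (Suc j) w) \<in> ?E2" unfolding QR(2)[OF w] .
  qed
  have "?T \<subseteq> P \<union> Q \<union> R" by (auto simp: P_def Q_def R_def)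
  then have "?T \<subseteq> ?V3" by blast
  moreover have anc: "(xs, take i xs) \<in> ?E3 \<and> (take i xs, xs) \<in> ?E3"
    if "xs \<in> ?T" "i \<in> {j, Suc j}" "i < length xs" for xs i
  proof (cases "xs \<in> R")
    case True
    then show ?thesis using that(2) by blast
  next
    case False
    then have "xs \<in> Q" "i = j" using that by (auto simp: Q_def R_def)
    then show ?thesis by blast
  qed
  have "tree_arcs h N {j, Suc j} \<subseteq> ?E3"
  proof (rule subrelI)
    fix xs ys assume "(xs, ys) \<in> tree_arcs h N {j, Suc j}"
    then obtain i where "xs \<in> ?T" "ys \<in> ?T" "i \<in> {j, Suc j}"
      "i < length xs \<and> ys = take i xs \<or> i < length ys \<and> xs = take i ys"
      unfolding tree_arcs_def by blast
    then show "(xs, ys) \<in> ?E3"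
      by (elim disjE conjE) (simp_all only: anc)
  qed
  ultimately show ?thesis using 3 by (intro exI conjI)
qed

lemma euler_genus_tree_closure: "euler_genus (tree_closure h N {j, Suc j}) \<le> enat g"
proof -
  obtain V E where VE: "sphere_drawing V E" "tree_nodes h N \<subseteq> V" "tree_arcs h N {j, Suc j} \<subseteq> E"
    using sphere_drawing_tree_closure[of h N j] by blast
  show ?thesis
  proof (rule sphere_drawing_genus[OF VE(1), of list_decode])
    show "inj_on list_decode (pverts (tree_closure h N {j, Suc j}))"
      using inj_list_decode by (rule inj_on_subset) (rule subset_UNIV)
    show "parcs (tree_closure h N {j, Suc j})
      \<subseteq> pverts (tree_closure h N {j, Suc j}) \<times> pverts (tree_closure h N {j, Suc j})"
      by (auto simp: tree_arcs_def)
  qed (use VE in auto)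
qed

lemma tree_closure_in_thickness_class:
  assumes "k \<ge> 1"
  shows "tree_closure (2 * k) N {..<2 * k} \<in> thickness_class g k"
proof -
  let ?G = "tree_closure (2 * k) N {..<2 * k}"
  let ?H = "\<lambda>i. tree_closure (2 * k) N {2 * i, Suc (2 * i)}"
  have J: "j \<in> {..<2 * k} \<longleftrightarrow> (\<exists>i<k. j \<in> {2 * i, Suc (2 * i)})" for j
  proof
    assume "j \<in> {..<2 * k}"
    then show "\<exists>i<k. j \<in> {2 * i, Suc (2 * i)}"
      by (intro exI[of _ "j div 2"]) (simp, presburger)
  qed auto
  have "{..<2 * k} = (\<Union>i<k. {2 * i, Suc (2 * i)})" using J by blast
  then have arcs: "parcs ?G = (\<Union>i<k. parcs (?H i))"
    by (simp only: tree_closure_simps tree_arcs_UN) blast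
  have verts: "pverts ?G = (\<Union>i<k. pverts (?H i))" using assms by (auto simp: lessThan_empty_iff)
  have "subgraph (with_proj (?H i)) (with_proj ?G)" if "i < k" for i
  proof -
    interpret G: pair_graph ?G by (rule pair_graph_tree_closure)
    interpret H: pair_graph "?H i" by (rule pair_graph_tree_closure)
    have "parcs (?H i) \<subseteq> parcs ?G" unfolding arcs using that by blast
    then show ?thesis
      unfolding subgraph_def compatible_def
      using G.wf_digraph_axioms H.wf_digraph_axioms by simp
  qed
  then have "g_thickness g ?G \<le> enat k"
    unfolding g_thickness_def
    by (intro Inf_lower CollectI exI[of _ k] exI[of _ ?H] conjI allI impI refl arcs verts
        pair_graph_tree_closure euler_genus_tree_closure)
  then show ?thesis by (simp add: thickness_class_def pair_graph_tree_closure)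
qed

text \<open>Going down from the root, each vertex of the path excludes at most \<open>d\<close>
  children of the current node, since all these children are its neighbours; in total fewer than
  \<open>N\<close> are excluded. Height \<open>h\<close> thus yields \<open>h + 1\<close> distinct
  colours, one too many.\<close>

lemma tree_closure_not_colourable:
  assumes "h * d < N"
  shows "\<not> defective_colourable h d (tree_closure h N {..<h})"
proof
  assume "defective_colourable h d (tree_closure h N {..<h})"
  then obtain c where c: "\<And>v. list_decode v \<in> tree_nodes h N \<Longrightarrow> c v < h"
    and defect: "\<And>v. list_decode v \<in> tree_nodes h N \<Longrightarrow>
      card {w. (list_decode v, list_decode w) \<in> tree_arcs h N {..<h} \<and> c w = c v} \<le> d"
    by (auto simp: defective_colourable_def has_defect_def)
  define C where "C xs = c (list_encode xs)" for xs
  have step: "\<exists>a<N. \<forall>j\<le>length xs. C (xs @ [a]) \<noteq> C (take j xs)"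
    if xs: "xs \<in> tree_nodes h N" "length xs < h" for xs
  proof (rule ccontr)
    assume *: "\<not> ?thesis"
    have child: "xs @ [a] \<in> tree_nodes h N" if "a < N" for a
      using xs that by (auto simp: tree_nodes_def)
    have arc: "(take j xs, xs @ [a]) \<in> tree_arcs h N {..<h}" if "a < N" "j \<le> length xs" for a j
      unfolding tree_arcs_def using child[OF that(1)] take_tree_nodes[OF xs(1)] that xs(2)
      by (auto intro!: bexI[of _ j])
    let ?S = "\<lambda>j. {a. a < N \<and> C (xs @ [a]) = C (take j xs)}"
    have "card (?S j) \<le> d" if j: "j \<le> length xs" for j
    proof -
      let ?v = "list_encode (take j xs)"
      let ?D = "{w. (list_decode ?v, list_decode w) \<in> tree_arcs h N {..<h} \<and> c w = c ?v}"
      have "(\<lambda>a. list_encode (xs @ [a])) ` ?S j \<subseteq> ?D"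
        using arc j by (auto simp: C_def)
      moreover have "finite ?D"
        by (rule finite_subset[of _ "pverts (tree_closure h N {..<h})"])
          (auto simp: tree_arcs_def pair_graphD(1)[OF pair_graph_tree_closure, simplified])
      ultimately have "card ((\<lambda>a. list_encode (xs @ [a])) ` ?S j) \<le> card ?D"
        by (intro card_mono)
      moreover have "card ((\<lambda>a. list_encode (xs @ [a])) ` ?S j) = card (?S j)"
        by (rule card_image) (simp add: inj_on_def list_encode_eq)
      ultimately show ?thesis using defect[of ?v] take_tree_nodes[OF xs(1)] by simp
    qed
    then have "(\<Sum>j\<le>length xs. card (?S j)) \<le> (\<Sum>j\<le>length xs. d)" by (intro sum_mono) auto
    also have "\<dots> \<le> h * d" using xs(2) mult_le_mono1[of "Suc (length xs)" h d] by simp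
    finally have "(\<Sum>j\<le>length xs. card (?S j)) \<le> h * d" .
    moreover have "{..<N} = (\<Union>j\<le>length xs. ?S j)" using * by auto
    then have "N \<le> (\<Sum>j\<le>length xs. card (?S j))"
      using card_UN_le[of "{..length xs}" ?S] by (metis card_lessThan finite_atMost)
    ultimately show False using assms by simp
  qed
  have "\<exists>xs\<in>tree_nodes h N. length xs = m \<and> inj_on (\<lambda>j. C (take j xs)) {..m}" if "m \<le> h" for m
    using that
  proof (induction m)
    case 0
    then show ?case by (intro bexI[of _ "[]"]) (auto simp: tree_nodes_def)
  next
    case (Suc m)
    then obtain xs where xs: "xs \<in> tree_nodes h N" "length xs = m"
      "inj_on (\<lambda>j. C (take j xs)) {..m}" by auto
    then obtain a where a: "a < N" "\<And>j. j \<le> m \<Longrightarrow> C (xs @ [a]) \<noteq> C (take j xs)"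
      using step[of xs] Suc.prems by auto
    have "inj_on (\<lambda>j. C (take j (xs @ [a]))) {..m}"
      using xs(2,3) by (simp add: inj_on_def)
    moreover have "C (take (Suc m) (xs @ [a])) \<notin> (\<lambda>j. C (take j (xs @ [a]))) ` {..m}"
      using a(2) xs(2) by auto
    ultimately have "inj_on (\<lambda>j. C (take j (xs @ [a]))) {..Suc m}"
      by (simp add: atMost_Suc)
    moreover have "xs @ [a] \<in> tree_nodes h N" using xs a Suc.prems by (auto simp: tree_nodes_def)
    ultimately show ?case using xs(2) by (intro bexI[of _ "xs @ [a]"]) auto
  qed
  then obtain xs where xs: "xs \<in> tree_nodes h N" "inj_on (\<lambda>j. C (take j xs)) {..h}" by blast
  have "(\<lambda>j. C (take j xs)) ` {..h} \<subseteq> {..<h}"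
    using c take_tree_nodes[OF xs(1)] by (auto simp: C_def)
  then have "card {..h} \<le> card {..<h}" using xs(2) by (intro card_inj_on_le) auto
  then show False by simp
qed

section \<open>The two defective numbers of the class\<close>

lemma defective_choosable_imp_colourable:
  assumes "defective_choosable k d G"
  shows "defective_colourable k d G"
  using assms[unfolded defective_choosable_def, rule_format, of "\<lambda>_. {..<k}"]
  by (auto simp: defective_colourable_def)

lemma defective_colourable_mono:
  "defective_colourable j d G \<Longrightarrow> j \<le> k \<Longrightarrow> defective_colourable k d G"
  unfolding defective_colourable_def by (meson less_le_trans)

lemma defective_number_lower_bound:
  assumes "k \<ge> 1" and col: "\<forall>G \<in> thickness_class g k. defective_colourable j d (G :: nat pair_pre_digraph)"
  shows "2 * k + 1 \<le> j"
proof (rule ccontr)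
  assume "\<not> 2 * k + 1 \<le> j"
  then have "j \<le> 2 * k" by simp
  \<comment> \<open>The branching has to exceed \<open>h * d\<close> for \<open>h = 2 * k\<close>,
    so each defect \<open>d\<close> is refuted by a graph of its own.\<close>
  let ?N = "Suc (2 * k * d)"
  have "defective_colourable j d (tree_closure (2 * k) ?N {..<2 * k})"
    using col tree_closure_in_thickness_class[OF assms(1)] by blast
  then have "defective_colourable (2 * k) d (tree_closure (2 * k) ?N {..<2 * k})"
    using \<open>j \<le> 2 * k\<close> by (rule defective_colourable_mono)
  then show False using tree_closure_not_colourable[of "2 * k" d ?N] by simp
qed

theorem theorem23:
  fixes g k :: nat
  assumes "k \<ge> 1"
  shows "defective_chromatic_number (thickness_class g k :: nat pair_pre_digraph set) = enat (2 * k + 1) \<and>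
    defective_choice_number (thickness_class g k :: nat pair_pre_digraph set) = enat (2 * k + 1) \<and>
    (\<forall>G :: 'a pair_pre_digraph. pair_graph G \<and> g_thickness g G \<le> enat k \<longrightarrow>
       defective_choosable (2 * k + 1) (2 * k * g + 8 * k\<^sup>2 + 2 * k) G)"
proof -
  let ?C = "thickness_class g k :: nat pair_pre_digraph set"
  let ?d = "2 * k * g + 8 * k\<^sup>2 + 2 * k"
  have choosable: "\<forall>G\<in>?C. defective_choosable (2 * k + 1) ?d G"
    using thickness_defective_choosable[OF assms] by (auto simp: thickness_class_def)
  then have colourable: "\<forall>G\<in>?C. defective_colourable (2 * k + 1) ?d G"
    using defective_choosable_imp_colourable by blast
  have "defective_chromatic_number ?C = enat (2 * k + 1)"
    unfolding defective_chromatic_number_def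
  proof (rule antisym)
    show "Inf {enat j | j. \<exists>d. \<forall>G\<in>?C. defective_colourable j d G} \<le> enat (2 * k + 1)"
      using colourable by (intro Inf_lower) blast
    show "enat (2 * k + 1) \<le> Inf {enat j | j. \<exists>d. \<forall>G\<in>?C. defective_colourable j d G}"
      using defective_number_lower_bound[OF assms] by (intro Inf_greatest) auto
  qed
  moreover have "defective_choice_number ?C = enat (2 * k + 1)"
    unfolding defective_choice_number_def
  proof (rule antisym)
    show "Inf {enat j | j. \<exists>d. \<forall>G\<in>?C. defective_choosable j d G} \<le> enat (2 * k + 1)"
      using choosable by (intro Inf_lower) blast
    show "enat (2 * k + 1) \<le> Inf {enat j | j. \<exists>d. \<forall>G\<in>?C. defective_choosable j d G}"
    proof (rule Inf_greatest)
      fix x assume "x \<in> {enat j | j. \<exists>d. \<forall>G\<in>?C. defective_choosable j d G}"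
      then obtain j d where x: "x = enat j" "\<forall>G\<in>?C. defective_choosable j d G" by blast
      then have "\<forall>G\<in>?C. defective_colourable j d G"
        using defective_choosable_imp_colourable by blast
      then have "2 * k + 1 \<le> j" by (rule defective_number_lower_bound[OF assms])
      then show "enat (2 * k + 1) \<le> x" using x(1) by simp
    qed
  qed
  ultimately show ?thesis using thickness_defective_choosable[OF assms] by blast
qed

end
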